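(* Assume that $\widehat F\colon H^1(\Omega)\times[H^1(\Omega)]^d\to\mathbb R$ is Fréchet differentiable and that the reduced functional $F$ has a Fréchet derivative admitting a primal representation $\nabla F\colon\mathcal A\to L^\infty(\Omega)$. Let $\{\alpha_k\}$ be a sequence of positive scalars and let $\{\rho_k\}$ be the sequence of densities generated by the SiMPL update with step sizes $\alpha_k$. Then there exist an (infinite) index set $K_{\rm w}\subset\mathbb N$ and $\rho^\star\in\mathcal A$ such that the subsequence $\{\rho_k\}_{k\in K_{\rm w}}$ converges weakly to $\rho^\star$ in $L^p(\Omega)$ for $p\in[1,\infty)$. Moreover, for the active sets $$\Omega_1:=\{x\in\Omega:\rho^\star(x)=1\},\qquad\Omega_0:=\{x\in\Omega:\rho^\star(x)=0\},$$ the sequences $\{(1-\rho_k)\chi_{\Omega_1}\}_{k\in K_{\rm w}}$ and $\{\rho_k\chi_{\Omega_0}\}_{k\in K_{\rm w}}$ converge in measure to zero. Finally, there exists an (infinite) index set $K_{\rm pn}\subset K_{\rm w}$ such that $\{(1-\rho_k)\chi_{\Omega_1}\}_{k\in K_{\rm pn}}$ and $\{\rho_k\chi_{\Omega_0}\}_{k\in K_{\rm pn}}$ converge to zero both pointwise (almost everywhere) and strongly in $L^p(\Omega)$, for every $p\in[1,\infty)$.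
   Context: $\Omega\subset\mathbb R^d$ ($d=2$ or $3$) is a bounded open domain with Lipschitz boundary; $|\cdot|$ is Lebesgue measure; $0\le\theta\le1$ is fixed. $L^p_\theta(\Omega)=\{\rho\in L^p(\Omega):\int_\Omega\rho\,dx=\theta|\Omega|\}$, $L^p_{[0,1]}(\Omega)=\{\rho\in L^p(\Omega):0\le\rho\le1\text{ a.e.}\}$, $\mathcal A=L^p_\theta(\Omega)\cap L^p_{[0,1]}(\Omega)$ (the same set for every $p$), $\operatorname{int}L^\infty_{[0,1]}(\Omega)=\{\rho\in L^\infty(\Omega):\operatorname{ess\,inf}\rho>0,\ \operatorname{ess\,sup}\rho<1\}$, and $\mathring{\mathcal A}=L^\infty_\theta(\Omega)\cap\operatorname{int}L^\infty_{[0,1]}(\Omega)$. $\chi_{\mathcal B}$ is the characteristic function of a measurable set $\mathcal B$. Reduced objective: for a density $\rho$ with $0\le\rho\le1$, $\tilde\rho\in H^1(\Omega)$ is the weak solution of $-\epsilon^2\Delta\tilde\rho+\tilde\rho=\rho$ in $\Omega$, $\nabla\tilde\rho\cdot n=0$ on $\partial\Omega$ ($\epsilon>0$ fixed); $u\in V=\{v\in[H^1(\Omega)]^d:v|_{\Gamma_0}=0\}$ is the weak solution of $-\operatorname{div}(r(\tilde\rho)\mathsf C\varepsilon(u))=f$ in $\Omega$, $u=0$ on $\Gamma_0$, $(\mathsf C\varepsilon(u))\cdot n=0$ on $\partial\Omega\setminus\Gamma_0$, where $\Gamma_0\subset\partial\Omega$ has positive Hausdorff measure, $\varepsilon(u)=(\nabla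 u+\nabla u^\top)/2$, $\mathsf C$ is a symmetric positive-definite elasticity tensor, $f$ is a given body force (such that the weak problem is well posed, e.g. $f\in[L^2(\Omega)]^d$), and $r(t)=\underline\rho+(1-\underline\rho)t^s$ with $0<\underline\rho\ll1$, $s>1$. The reduced objective is $F(\rho)=\widehat F(\tilde\rho(\rho),u(\tilde\rho(\rho)))$. Its Fréchet derivative (with respect to $L^\infty(\Omega)$) is represented by $\nabla F(\rho)$: $\langle F'(\rho),q\rangle=\int_\Omega\nabla F(\rho)q\,dx$ for all $q\in L^\infty(\Omega)$. SiMPL update: with $\sigma(t)=1/(1+e^{-t})$, start from some $\rho_0\in\mathring{\mathcal A}$ and, for $k=0,1,2,\dots$, set $\rho_{k+1}=\sigma(\sigma^{-1}(\rho_k)-\alpha_k\nabla F(\rho_k)-\mu_{k+1})$, where $\mu_{k+1}\in\mathbb R$ is the unique number with $\int_\Omega\sigma(\sigma^{-1}(\rho_k)-\alpha_k\nabla F(\rho_k)-\mu_{k+1})\,dx=\theta|\Omega|$. All iterates $\rho_k$ then lie in $\mathring{\mathcal A}$. *)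

theory Defs
  imports
    "HOL-Analysis.Analysis"
    "HOL-Probability.Essential_Supremum"
    "HOL-Library.Function_Algebras"
begin

text \<open>
  Elements of \<open>L\<^sup>p\<close> and \<open>H\<^sup>1\<close> are represented by functions on the whole space; only their values on
  \<open>\<Omega>\<close>, up to Lebesgue null sets, matter. The norms below are therefore seminorms on representatives.
\<close>

instantiation "fun" :: (type, real_vector) real_vector
begin

definition scaleR_fun_def: "c *\<^sub>R f = (\<lambda>x. c *\<^sub>R f x)"

instance
  by standard (simp_all add: scaleR_fun_def plus_fun_def scaleR_add_right scaleR_add_left)

end


section \<open>Bounded functionals and Frechet derivatives on seminormed function spaces\<close>

definition bounded_functional ::
    "'v::real_vector set \<Rightarrow> ('v \<Rightarrow> real) \<Rightarrow> ('v \<Rightarrow> real) \<Rightarrow> bool" where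
  "bounded_functional X N l \<longleftrightarrow>
     (\<forall>x\<in>X. \<forall>y\<in>X. l (x + y) = l x + l y) \<and>
     (\<forall>c. \<forall>x\<in>X. l (c *\<^sub>R x) = c * l x) \<and>
     (\<exists>B. \<forall>x\<in>X. \<bar>l x\<bar> \<le> B * N x)"

text \<open>
  \<open>D\<close> is a Frechet derivative at \<open>x\<close>, relative to the subset \<open>S\<close> of \<open>X\<close>, of the functional \<open>f\<close>.
  Since the remainder is bounded by the seminorm of the increment, a functional that is differentiable
  at every point of \<open>S = X\<close> takes equal values at points with seminorm distance zero, i.e. it is a
  functional on the space of equivalence classes.
\<close>

definition has_frechet_derivative_within ::
    "'v::real_vector set \<Rightarrow> ('v \<Rightarrow> real) \<Rightarrow> 'v set \<Rightarrow> ('v \<Rightarrow> real) \<Rightarrow> ('v \<Rightarrow> real) \<Rightarrow> 'v \<Rightarrow> bool" where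
  "has_frechet_derivative_within X N S f D x \<longleftrightarrow>
     bounded_functional X N D \<and>
     (\<forall>e>0. \<exists>\<delta>>0. \<forall>y\<in>S. N (y - x) < \<delta> \<longrightarrow> \<bar>f y - f x - D (y - x)\<bar> \<le> e * N (y - x))"


section \<open>Lebesgue spaces and densities\<close>

definition Lp :: "real \<Rightarrow> 'a::euclidean_space set \<Rightarrow> ('a \<Rightarrow> real) set" where
  "Lp p \<Omega> = {f \<in> borel_measurable (lebesgue_on \<Omega>).
              integrable (lebesgue_on \<Omega>) (\<lambda>x. \<bar>f x\<bar> powr p)}"

definition Lp_norm :: "real \<Rightarrow> 'a::euclidean_space set \<Rightarrow> ('a \<Rightarrow> real) \<Rightarrow> real" where
  "Lp_norm p \<Omega> f = (LINT x|lebesgue_on \<Omega>. \<bar>f x\<bar> powr p) powr (1 / p)"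

definition Linf :: "'a::euclidean_space set \<Rightarrow> ('a \<Rightarrow> real) set" where
  "Linf \<Omega> = {f \<in> borel_measurable (lebesgue_on \<Omega>).
              esssup (lebesgue_on \<Omega>) (\<lambda>x. ereal \<bar>f x\<bar>) < \<infinity>}"

definition Linf_norm :: "'a::euclidean_space set \<Rightarrow> ('a \<Rightarrow> real) \<Rightarrow> real" where
  "Linf_norm \<Omega> f = real_of_ereal (esssup (lebesgue_on \<Omega>) (\<lambda>x. ereal \<bar>f x\<bar>))"

definition mass_constraint :: "real \<Rightarrow> 'a::euclidean_space set \<Rightarrow> ('a \<Rightarrow> real) set" where
  "mass_constraint \<theta> \<Omega> = {\<rho>. (LINT x|lebesgue_on \<Omega>. \<rho> x) = \<theta> * measure lebesgue \<Omega>}"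

definition box_constraint :: "'a::euclidean_space set \<Rightarrow> ('a \<Rightarrow> real) set" where
  "box_constraint \<Omega> = {\<rho>. AE x in lebesgue_on \<Omega>. 0 \<le> \<rho> x \<and> \<rho> x \<le> 1}"

definition admissible :: "real \<Rightarrow> 'a::euclidean_space set \<Rightarrow> ('a \<Rightarrow> real) set" where
  "admissible \<theta> \<Omega> = (Linf \<Omega> \<inter> mass_constraint \<theta> \<Omega>) \<inter> (Linf \<Omega> \<inter> box_constraint \<Omega>)"

definition int_box :: "'a::euclidean_space set \<Rightarrow> ('a \<Rightarrow> real) set" where
  "int_box \<Omega> = {\<rho> \<in> Linf \<Omega>.
       - esssup (lebesgue_on \<Omega>) (\<lambda>x. - ereal (\<rho> x)) > 0 \<and>
       esssup (lebesgue_on \<Omega>) (\<lambda>x. ereal (\<rho> x)) < 1}"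

definition int_admissible :: "real \<Rightarrow> 'a::euclidean_space set \<Rightarrow> ('a \<Rightarrow> real) set" where
  "int_admissible \<theta> \<Omega> = (Linf \<Omega> \<inter> mass_constraint \<theta> \<Omega>) \<inter> int_box \<Omega>"

lemma admissible_eq_Lp:
  assumes "open \<Omega>" "bounded \<Omega>" "p \<ge> 1"
  shows "admissible \<theta> \<Omega> = (Lp p \<Omega> \<inter> mass_constraint \<theta> \<Omega>) \<inter> (Lp p \<Omega> \<inter> box_constraint \<Omega>)"
proof -
  have fm: "finite_measure (lebesgue_on \<Omega>)"
    using assms(1,2) by (simp add: bounded_set_imp_lmeasurable borel_open finite_measure_lebesgue_on)
  have "\<rho> \<in> Linf \<Omega> \<longleftrightarrow> \<rho> \<in> Lp p \<Omega>" if box: "\<rho> \<in> box_constraint \<Omega>" for \<rho>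
  proof -
    have ae: "AE x in lebesgue_on \<Omega>. 0 \<le> \<rho> x \<and> \<rho> x \<le> 1"
      using box by (simp add: box_constraint_def)
    have "esssup (lebesgue_on \<Omega>) (\<lambda>x. ereal \<bar>\<rho> x\<bar>) < \<infinity>"
      if m: "\<rho> \<in> borel_measurable (lebesgue_on \<Omega>)"
    proof -
      have "esssup (lebesgue_on \<Omega>) (\<lambda>x. ereal \<bar>\<rho> x\<bar>) \<le> 1"
      proof (rule esssup_I)
        show "AE x in lebesgue_on \<Omega>. ereal \<bar>\<rho> x\<bar> \<le> 1"
          using ae by eventually_elim auto
      qed (use m in measurable)
      then show ?thesis by (auto intro: le_less_trans)
    qed
    moreover have "integrable (lebesgue_on \<Omega>) (\<lambda>x. \<bar>\<rho> x\<bar> powr p)"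
      if m: "\<rho> \<in> borel_measurable (lebesgue_on \<Omega>)"
    proof (rule finite_measure.integrable_const_bound[OF fm, where B = 1])
      show "AE x in lebesgue_on \<Omega>. norm (\<bar>\<rho> x\<bar> powr p) \<le> 1"
        using ae by eventually_elim (use assms(3) in \<open>auto intro: powr_le1\<close>)
    qed (use m in measurable)
    ultimately show ?thesis by (auto simp: Linf_def Lp_def)
  qed
  then show ?thesis by (auto simp: admissible_def)
qed


section \<open>Lipschitz domains and surface measure\<close>

text \<open>Near each boundary point, \<open>\<Omega>\<close> is the strict epigraph, in some direction \<open>e\<close>, of a Lipschitz
  function on the hyperplane orthogonal to \<open>e\<close>.\<close>

definition lipschitz_boundary :: "'a::euclidean_space set \<Rightarrow> bool" where
  "lipschitz_boundary \<Omega> \<longleftrightarrow>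
     (\<forall>x\<in>frontier \<Omega>. \<exists>U e \<gamma> L. open U \<and> x \<in> U \<and> norm e = 1 \<and>
        L-lipschitz_on {z. z \<bullet> e = 0} \<gamma> \<and>
        \<Omega> \<inter> U = {y \<in> U. \<gamma> (y - (y \<bullet> e) *\<^sub>R e) < y \<bullet> e})"

text \<open>The Hausdorff measure is not normalised by the volume of the unit ball; only positivity,
  null sets and convergence of integrals are used. Empty covering sets contribute nothing.\<close>

definition hausdorff_pre :: "nat \<Rightarrow> real \<Rightarrow> 'a::euclidean_space set \<Rightarrow> ennreal" where
  "hausdorff_pre s \<delta> A =
     (INF C \<in> {C :: nat \<Rightarrow> 'a set. (\<forall>i. bounded (C i) \<and> diameter (C i) \<le> \<delta>) \<and> A \<subseteq> (\<Union>i. C i)}.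
        \<Sum>i. if C i = {} then 0 else ennreal (diameter (C i) ^ s))"

definition hausdorff_outer :: "nat \<Rightarrow> 'a::euclidean_space set \<Rightarrow> ennreal" where
  "hausdorff_outer s A = (SUP \<delta>\<in>{0<..}. hausdorff_pre s \<delta> A)"

definition surface_measure :: "'a::euclidean_space measure" where
  "surface_measure = measure_of UNIV (sets borel) (hausdorff_outer (DIM('a) - 1))"


section \<open>Sobolev spaces\<close>

definition partial :: "'d::finite \<Rightarrow> (real^'d \<Rightarrow> real) \<Rightarrow> real^'d \<Rightarrow> real" where
  "partial i f x = frechet_derivative f (at x) (axis i 1)"

primrec Ck :: "nat \<Rightarrow> (real^'d::finite \<Rightarrow> real) \<Rightarrow> bool" where
  "Ck 0 f \<longleftrightarrow> continuous_on UNIV f"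
| "Ck (Suc n) f \<longleftrightarrow> (\<forall>x. f differentiable (at x)) \<and> (\<forall>i. Ck n (partial i f))"

definition smooth :: "(real^'d::finite \<Rightarrow> real) \<Rightarrow> bool" where
  "smooth f \<longleftrightarrow> (\<forall>n. Ck n f)"

definition test_functions :: "(real^'d::finite) set \<Rightarrow> (real^'d \<Rightarrow> real) set" where
  "test_functions \<Omega> =
     {\<phi>. smooth \<phi> \<and> compact (closure {x. \<phi> x \<noteq> 0}) \<and> closure {x. \<phi> x \<noteq> 0} \<subseteq> \<Omega>}"

definition has_weak_gradient ::
    "(real^'d::finite) set \<Rightarrow> (real^'d \<Rightarrow> real) \<Rightarrow> (real^'d \<Rightarrow> real^'d) \<Rightarrow> bool" where
  "has_weak_gradient \<Omega> f G \<longleftrightarrow>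
     (\<forall>i. (\<lambda>x. G x $ i) \<in> Lp 2 \<Omega> \<and>
       (\<forall>\<phi>\<in>test_functions \<Omega>.
          (LINT x|lebesgue_on \<Omega>. f x * partial i \<phi> x) = - (LINT x|lebesgue_on \<Omega>. G x $ i * \<phi> x)))"

definition H1 :: "(real^'d::finite) set \<Rightarrow> (real^'d \<Rightarrow> real) set" where
  "H1 \<Omega> = {f \<in> Lp 2 \<Omega>. \<exists>G. has_weak_gradient \<Omega> f G}"

text \<open>The weak gradient is unique almost everywhere in \<open>\<Omega>\<close>.\<close>

definition weak_gradient :: "(real^'d::finite) set \<Rightarrow> (real^'d \<Rightarrow> real) \<Rightarrow> real^'d \<Rightarrow> real^'d" where
  "weak_gradient \<Omega> f = (SOME G. has_weak_gradient \<Omega> f G)"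

definition H1_norm :: "(real^'d::finite) set \<Rightarrow> (real^'d \<Rightarrow> real) \<Rightarrow> real" where
  "H1_norm \<Omega> f = sqrt ((LINT x|lebesgue_on \<Omega>. (f x)\<^sup>2) +
                       (LINT x|lebesgue_on \<Omega>. (norm (weak_gradient \<Omega> f x))\<^sup>2))"

definition H1vec :: "(real^'d::finite) set \<Rightarrow> (real^'d \<Rightarrow> real^'d) set" where
  "H1vec \<Omega> = {v. \<forall>i. (\<lambda>x. v x $ i) \<in> H1 \<Omega>}"

definition H1vec_norm :: "(real^'d::finite) set \<Rightarrow> (real^'d \<Rightarrow> real^'d) \<Rightarrow> real" where
  "H1vec_norm \<Omega> v = sqrt (\<Sum>i\<in>UNIV. (H1_norm \<Omega> (\<lambda>x. v x $ i))\<^sup>2)"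

definition H1prod_norm ::
    "(real^'d::finite) set \<Rightarrow> (real^'d \<Rightarrow> real) \<times> (real^'d \<Rightarrow> real^'d) \<Rightarrow> real" where
  "H1prod_norm \<Omega> w = sqrt ((H1_norm \<Omega> (fst w))\<^sup>2 + (H1vec_norm \<Omega> (snd w))\<^sup>2)"

text \<open>The trace is the continuous extension to \<open>H\<^sup>1\<close> of the restriction of functions smooth up to
  the boundary, with values in \<open>L\<^sup>2\<close> of the boundary.\<close>

definition has_trace ::
    "(real^'d::finite) set \<Rightarrow> (real^'d \<Rightarrow> real) \<Rightarrow> (real^'d \<Rightarrow> real) \<Rightarrow> bool" where
  "has_trace \<Omega> v g \<longleftrightarrow> v \<in> H1 \<Omega> \<and> g \<in> borel_measurable borel \<and>
     (\<exists>\<phi>::nat \<Rightarrow> real^'d \<Rightarrow> real. (\<forall>n. smooth (\<phi> n)) \<and>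
        (\<lambda>n. H1_norm \<Omega> (v - \<phi> n)) \<longlonglongrightarrow> 0 \<and>
        (\<lambda>n. \<integral>\<^sup>+x\<in>frontier \<Omega>. ennreal ((\<phi> n x - g x)\<^sup>2) \<partial>surface_measure) \<longlonglongrightarrow> 0)"

definition displacement_space ::
    "(real^'d::finite) set \<Rightarrow> (real^'d) set \<Rightarrow> (real^'d \<Rightarrow> real^'d) set" where
  "displacement_space \<Omega> \<Gamma>\<^sub>0 = {v \<in> H1vec \<Omega>. \<forall>i. \<exists>g. has_trace \<Omega> (\<lambda>x. v x $ i) g \<and>
     hausdorff_outer (CARD('d) - 1) {x \<in> \<Gamma>\<^sub>0. g x \<noteq> 0} = 0}"


section \<open>Filter equation, elasticity equation and reduced objective\<close>

definition filter_solution ::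
    "(real^'d::finite) set \<Rightarrow> real \<Rightarrow> (real^'d \<Rightarrow> real) \<Rightarrow> (real^'d \<Rightarrow> real) \<Rightarrow> bool" where
  "filter_solution \<Omega> \<epsilon> \<rho> \<rho>t \<longleftrightarrow> \<rho>t \<in> H1 \<Omega> \<and>
     (\<forall>v\<in>H1 \<Omega>.
        \<epsilon>\<^sup>2 * (LINT x|lebesgue_on \<Omega>. weak_gradient \<Omega> \<rho>t x \<bullet> weak_gradient \<Omega> v x) +
        (LINT x|lebesgue_on \<Omega>. \<rho>t x * v x) = (LINT x|lebesgue_on \<Omega>. \<rho> x * v x))"

definition strain :: "(real^'d::finite) set \<Rightarrow> (real^'d \<Rightarrow> real^'d) \<Rightarrow> real^'d \<Rightarrow> real^'d^'d" where
  "strain \<Omega> v x = (let J = (\<chi> i. weak_gradient \<Omega> (\<lambda>y. v y $ i) x) in (1/2) *\<^sub>R (J + transpose J))"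

text \<open>The inner product of \<open>real^'d^'d\<close> is the Frobenius inner product. Only the action of
  the elasticity tensor on symmetric matrices is relevant.\<close>

definition elasticity_tensor :: "(real^'d^'d \<Rightarrow> real^'d^'d::finite) \<Rightarrow> bool" where
  "elasticity_tensor C \<longleftrightarrow> linear C \<and>
     (\<forall>A. transpose A = A \<longrightarrow> transpose (C A) = C A) \<and>
     (\<forall>A B. transpose A = A \<longrightarrow> transpose B = B \<longrightarrow> C A \<bullet> B = A \<bullet> C B) \<and>
     (\<forall>A. transpose A = A \<longrightarrow> A \<noteq> 0 \<longrightarrow> C A \<bullet> A > 0)"

definition simp_law :: "real \<Rightarrow> real \<Rightarrow> real \<Rightarrow> real" where
  "simp_law \<rho>min s t = \<rho>min + (1 - \<rho>min) * t powr s"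

text \<open>The body force enters as an element \<open>f\<close> of the dual of the displacement space; a force density
  \<open>b\<close> with square integrable components corresponds to \<open>f v = (LINT x|lebesgue_on \<Omega>. b x \<bullet> v x)\<close>.\<close>

definition elasticity_solution ::
    "(real^'d::finite) set \<Rightarrow> (real^'d) set \<Rightarrow> real \<Rightarrow> real \<Rightarrow> (real^'d^'d \<Rightarrow> real^'d^'d) \<Rightarrow>
     ((real^'d \<Rightarrow> real^'d) \<Rightarrow> real) \<Rightarrow> (real^'d \<Rightarrow> real) \<Rightarrow> (real^'d \<Rightarrow> real^'d) \<Rightarrow> bool" where
  "elasticity_solution \<Omega> \<Gamma>\<^sub>0 \<rho>min s C f \<rho>t u \<longleftrightarrow> u \<in> displacement_space \<Omega> \<Gamma>\<^sub>0 \<and>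
     (\<forall>v\<in>displacement_space \<Omega> \<Gamma>\<^sub>0.
        (LINT x|lebesgue_on \<Omega>. simp_law \<rho>min s (\<rho>t x) * (C (strain \<Omega> u x) \<bullet> strain \<Omega> v x)) = f v)"

text \<open>Both weak problems are uniquely solvable up to null sets (Lax-Milgram), and the filtered density
  of a density with values in \<open>[0,1]\<close> again has values in \<open>[0,1]\<close>.\<close>

definition filtered_density :: "(real^'d::finite) set \<Rightarrow> real \<Rightarrow> (real^'d \<Rightarrow> real) \<Rightarrow> real^'d \<Rightarrow> real" where
  "filtered_density \<Omega> \<epsilon> \<rho> = (SOME \<rho>t. filter_solution \<Omega> \<epsilon> \<rho> \<rho>t)"

definition displacement ::
    "(real^'d::finite) set \<Rightarrow> (real^'d) set \<Rightarrow> real \<Rightarrow> real \<Rightarrow> (real^'d^'d \<Rightarrow> real^'d^'d) \<Rightarrow>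
     ((real^'d \<Rightarrow> real^'d) \<Rightarrow> real) \<Rightarrow> (real^'d \<Rightarrow> real) \<Rightarrow> real^'d \<Rightarrow> real^'d" where
  "displacement \<Omega> \<Gamma>\<^sub>0 \<rho>min s C f \<rho>t = (SOME u. elasticity_solution \<Omega> \<Gamma>\<^sub>0 \<rho>min s C f \<rho>t u)"

definition reduced_objective ::
    "(real^'d::finite) set \<Rightarrow> (real^'d) set \<Rightarrow> real \<Rightarrow> real \<Rightarrow> real \<Rightarrow> (real^'d^'d \<Rightarrow> real^'d^'d) \<Rightarrow>
     ((real^'d \<Rightarrow> real^'d) \<Rightarrow> real) \<Rightarrow> ((real^'d \<Rightarrow> real) \<times> (real^'d \<Rightarrow> real^'d) \<Rightarrow> real) \<Rightarrow>
     (real^'d \<Rightarrow> real) \<Rightarrow> real" where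
  "reduced_objective \<Omega> \<Gamma>\<^sub>0 \<epsilon> \<rho>min s C f Fhat \<rho> =
     (let \<rho>t = filtered_density \<Omega> \<epsilon> \<rho> in Fhat (\<rho>t, displacement \<Omega> \<Gamma>\<^sub>0 \<rho>min s C f \<rho>t))"


section \<open>The SiMPL update\<close>

definition sigmoid :: "real \<Rightarrow> real" where
  "sigmoid t = 1 / (1 + exp (- t))"

text \<open>\<open>inv sigmoid\<close> is the inverse on \<open>{0<..<1}\<close>, where the iterates take their values almost everywhere.
  The integral is strictly decreasing in \<open>\<mu>\<close>, so the multiplier is unique.\<close>

definition simpl_step ::
    "'a::euclidean_space set \<Rightarrow> real \<Rightarrow> real \<Rightarrow> ('a \<Rightarrow> real) \<Rightarrow> ('a \<Rightarrow> real) \<Rightarrow> ('a \<Rightarrow> real) \<Rightarrow> bool" where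
  "simpl_step \<Omega> \<theta> \<alpha> g \<rho> \<rho>' \<longleftrightarrow>
     (\<exists>\<mu>. (LINT x|lebesgue_on \<Omega>. sigmoid (inv sigmoid (\<rho> x) - \<alpha> * g x - \<mu>)) = \<theta> * measure lebesgue \<Omega> \<and>
          (AE x in lebesgue_on \<Omega>. \<rho>' x = sigmoid (inv sigmoid (\<rho> x) - \<alpha> * g x - \<mu>)))"


section \<open>Modes of convergence along an index set\<close>

text \<open>Limits of a sequence along the indices in \<open>K\<close>; the filter is proper iff \<open>K\<close> is infinite.\<close>

definition along :: "nat set \<Rightarrow> nat filter" where
  "along K = inf sequentially (principal K)"

definition weakly_converges_Lp ::
    "real \<Rightarrow> 'a::euclidean_space set \<Rightarrow> nat set \<Rightarrow> (nat \<Rightarrow> 'a \<Rightarrow> real) \<Rightarrow> ('a \<Rightarrow> real) \<Rightarrow> bool" where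
  "weakly_converges_Lp p \<Omega> K f g \<longleftrightarrow>
     (\<forall>k\<in>K. f k \<in> Lp p \<Omega>) \<and> g \<in> Lp p \<Omega> \<and>
     (\<forall>l. bounded_functional (Lp p \<Omega>) (Lp_norm p \<Omega>) l \<longrightarrow> ((\<lambda>k. l (f k)) \<longlongrightarrow> l g) (along K))"

definition converges_Lp ::
    "real \<Rightarrow> 'a::euclidean_space set \<Rightarrow> nat set \<Rightarrow> (nat \<Rightarrow> 'a \<Rightarrow> real) \<Rightarrow> ('a \<Rightarrow> real) \<Rightarrow> bool" where
  "converges_Lp p \<Omega> K f g \<longleftrightarrow>
     (\<forall>k\<in>K. f k \<in> Lp p \<Omega>) \<and> g \<in> Lp p \<Omega> \<and>
     ((\<lambda>k. Lp_norm p \<Omega> (f k - g)) \<longlongrightarrow> 0) (along K)"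

definition converges_in_measure ::
    "'a::euclidean_space set \<Rightarrow> nat set \<Rightarrow> (nat \<Rightarrow> 'a \<Rightarrow> real) \<Rightarrow> ('a \<Rightarrow> real) \<Rightarrow> bool" where
  "converges_in_measure \<Omega> K f g \<longleftrightarrow>
     (\<forall>k\<in>K. f k \<in> borel_measurable (lebesgue_on \<Omega>)) \<and> g \<in> borel_measurable (lebesgue_on \<Omega>) \<and>
     (\<forall>\<eta>>0. ((\<lambda>k. measure (lebesgue_on \<Omega>) {x \<in> \<Omega>. \<bar>f k x - g x\<bar> \<ge> \<eta>}) \<longlongrightarrow> 0) (along K))"

definition converges_AE ::
    "'a::euclidean_space set \<Rightarrow> nat set \<Rightarrow> (nat \<Rightarrow> 'a \<Rightarrow> real) \<Rightarrow> ('a \<Rightarrow> real) \<Rightarrow> bool" where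
  "converges_AE \<Omega> K f g \<longleftrightarrow> (AE x in lebesgue_on \<Omega>. ((\<lambda>k. f k x) \<longlongrightarrow> g x) (along K))"

end

theory Submission
  imports Defs
begin

text \<open>
  The iterates stay admissible, so they are bounded by \<open>1\<close> on a set of finite measure. The elements of
  almost minimal \<open>L\<^sup>2\<close> norm in the convex hulls of the tails of a suitable subsequence form a Cauchy
  sequence by the parallelogram law, and their limit is the weak limit \<open>\<rho>\<^sup>\<star>\<close> of the subsequence.
  Weak convergence in \<open>L\<^sup>p\<close> needs no representation of the dual space: if a bounded functional stayed
  away from zero on infinitely many differences \<open>\<rho>\<^sub>k - \<rho>\<^sup>\<star>\<close>, averages of almost orthogonal ones would
  tend to zero in \<open>L\<^sup>2\<close>, hence (being bounded by \<open>1\<close>) in every \<open>L\<^sup>p\<close>, a contradiction.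
  On the active sets \<open>1 - \<rho>\<^sub>k\<close> and \<open>\<rho>\<^sub>k\<close> are nonnegative, so testing weak convergence with the indicator
  functions of these sets gives \<open>L\<^sup>1\<close> convergence to zero, and the remaining modes follow.
\<close>

section \<open>Integrals of essentially bounded functions on a finite measure space\<close>

lemma (in finite_measure) integrable_mult_AE_bounded:
  fixes f g :: "'a \<Rightarrow> real"
  assumes [measurable]: "f \<in> borel_measurable M" "g \<in> borel_measurable M"
    and f: "AE x in M. \<bar>f x\<bar> \<le> a" and g: "AE x in M. \<bar>g x\<bar> \<le> b"
  shows "integrable M (\<lambda>x. f x * g x)"
proof (rule integrable_const_bound[where B = "a * b"])
  show "AE x in M. norm (f x * g x) \<le> a * b"
    using f g by eventually_elim (auto simp: abs_mult intro!: mult_mono)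
qed measurable

lemma (in finite_measure) integrable_AE_bounded:
  fixes f :: "'a \<Rightarrow> real"
  assumes [measurable]: "f \<in> borel_measurable M" and "AE x in M. \<bar>f x\<bar> \<le> a"
  shows "integrable M f"
  using assms by (intro integrable_const_bound[where B = a]) auto

lemma (in finite_measure) integrable_powr_AE_bounded:
  fixes f :: "'a \<Rightarrow> real"
  assumes [measurable]: "f \<in> borel_measurable M" and f: "AE x in M. \<bar>f x\<bar> \<le> a" and "0 \<le> p"
  shows "integrable M (\<lambda>x. \<bar>f x\<bar> powr p)"
proof (rule integrable_AE_bounded[where a = "a powr p"])
  show "AE x in M. \<bar>\<bar>f x\<bar> powr p\<bar> \<le> a powr p"
    using f by eventually_elim (use \<open>0 \<le> p\<close> in \<open>auto intro: powr_mono2\<close>)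
qed measurable

text \<open>Split at the level \<open>d\<close>. Where the modulus of \<open>f\<close> is at most
  \<open>d\<close>, its \<open>p\<close>-th power is at most the modulus itself, because
  \<open>f\<close> is bounded by 1 and \<open>1 \<le> p\<close>. Elsewhere the power is at most 1,
  which is at most \<open>f x * f x / d\<^sup>2\<close>.\<close>

lemma (in finite_measure) integral_powr_le_integral_square:
  fixes f :: "'a \<Rightarrow> real"
  assumes f_meas[measurable]: "f \<in> borel_measurable M" and f: "AE x in M. \<bar>f x\<bar> \<le> 1"
    and p: "1 \<le> p" and d: "0 < d" "d \<le> 1"
  shows "(LINT x|M. \<bar>f x\<bar> powr p) \<le> d * measure M (space M) + (LINT x|M. f x * f x) / d\<^sup>2"
proof -
  have i: "integrable M (\<lambda>x. f x * f x)"
    by (rule integrable_mult_AE_bounded[OF f_meas f_meas f f])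
  have "(LINT x|M. \<bar>f x\<bar> powr p) \<le> (LINT x|M. d + f x * f x / d\<^sup>2)"
  proof (rule integral_mono_AE)
    show "integrable M (\<lambda>x. \<bar>f x\<bar> powr p)"
      using integrable_powr_AE_bounded[OF f_meas f] p by simp
    show "integrable M (\<lambda>x. d + f x * f x / d\<^sup>2)"
      using i by simp
    show "AE x in M. \<bar>f x\<bar> powr p \<le> d + f x * f x / d\<^sup>2"
      using f
    proof eventually_elim
      case (elim x)
      show ?case
      proof (cases "\<bar>f x\<bar> \<le> d")
        case True
        have "\<bar>f x\<bar> powr p \<le> \<bar>f x\<bar>"
          using powr_mono'[of 1 p "\<bar>f x\<bar>"] p elim by simp
        with True show ?thesis by (smt (verit) divide_nonneg_nonneg zero_le_power2 zero_le_square)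
      next
        case False
        have "d\<^sup>2 \<le> f x * f x"
          using False d by (metis abs_mult_self_eq less_eq_real_def linorder_not_le mult_mono power2_eq_square abs_ge_zero)
        then have "1 \<le> f x * f x / d\<^sup>2"
          using d by simp
        moreover have "\<bar>f x\<bar> powr p \<le> 1"
          using elim p by (simp add: powr_le1)
        ultimately show ?thesis using d by linarith
      qed
    qed
  qed
  also have "\<dots> = d * measure M (space M) + (LINT x|M. f x * f x) / d\<^sup>2"
    using i by simp
  finally show ?thesis .
qed

text \<open>For functions bounded by 1, smallness in L^2 controls every L^p. The filter is arbitrary
  because both ordinary sequences and the double sequence of a Cauchy argument are treated this
  way.\<close>

lemma (in finite_measure) integral_powr_tendsto_zero:
  fixes f :: "'i \<Rightarrow> 'a \<Rightarrow> real"
  assumes f_meas: "\<And>i. f i \<in> borel_measurable M" and f: "\<And>i. AE x in M. \<bar>f i x\<bar> \<le> 1"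
    and p: "1 \<le> p" and lim: "((\<lambda>i. LINT x|M. f i x * f i x) \<longlongrightarrow> 0) F"
  shows "((\<lambda>i. LINT x|M. \<bar>f i x\<bar> powr p) \<longlongrightarrow> 0) F"
proof (rule tendstoI)
  fix e :: real assume e: "0 < e"
  define V where "V = measure M (space M)"
  have V: "0 \<le> V" by (simp add: V_def)
  \<comment> \<open>The level makes the first term of the split smaller than \<open>e / 2\<close>.
    The summand 1 in \<open>V + 1\<close> covers a space of measure zero.\<close>
  define d where "d = min 1 (e / (2 * (V + 1)))"
  have d: "0 < d" "d \<le> 1" using e V by (auto simp: d_def)
  have dV: "d * V < e / 2"
  proof -
    have "d * V < d * (V + 1)" using d by simp
    also have "\<dots> \<le> e / (2 * (V + 1)) * (V + 1)"
      using V by (intro mult_right_mono) (auto simp: d_def)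
    also have "\<dots> = e / 2" using V by (simp add: field_simps)
    finally show ?thesis .
  qed
  have "eventually (\<lambda>i. (LINT x|M. f i x * f i x) < e / 2 * d\<^sup>2) F"
    using lim by (rule order_tendstoD) (use e d in simp)
  then show "eventually (\<lambda>i. dist (LINT x|M. \<bar>f i x\<bar> powr p) 0 < e) F"
  proof eventually_elim
    case (elim i)
    then have "(LINT x|M. f i x * f i x) / d\<^sup>2 < e / 2" using d by (simp add: field_simps)
    then have "(LINT x|M. \<bar>f i x\<bar> powr p) < e"
      using integral_powr_le_integral_square[OF f_meas f p d, of i] dV
      unfolding V_def by linarith
    then show ?case by (simp add: dist_real_def)
  qed
qed

section \<open>Bounded functionals on L^p along almost orthogonal sequences\<close>

lemma Lp_AE_bounded:
  assumes "finite_measure (lebesgue_on \<Omega>)" "f \<in> borel_measurable (lebesgue_on \<Omega>)"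
    "AE x in lebesgue_on \<Omega>. \<bar>f x\<bar> \<le> a" "0 \<le> p"
  shows "f \<in> Lp p \<Omega>"
  using finite_measure.integrable_powr_AE_bounded[OF assms] assms(2) by (simp add: Lp_def)

lemma Lp_norm_tendsto_zero:
  assumes "finite_measure (lebesgue_on \<Omega>)" "\<And>i. f i \<in> borel_measurable (lebesgue_on \<Omega>)"
    "\<And>i. AE x in lebesgue_on \<Omega>. \<bar>f i x\<bar> \<le> 1"
    "1 \<le> p" "((\<lambda>i. LINT x|lebesgue_on \<Omega>. f i x * f i x) \<longlongrightarrow> 0) F"
  shows "((\<lambda>i. Lp_norm p \<Omega> (f i)) \<longlongrightarrow> 0) F"
  unfolding Lp_norm_def
  using finite_measure.integral_powr_tendsto_zero[OF assms] \<open>1 \<le> p\<close>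
  by (intro tendsto_zero_powrI) auto

text \<open>In the spirit of Banach and Saks: sums of \<open>N\<close> almost orthogonal terms have \<open>L\<^sup>2\<close> norm of
  order \<open>\<surd>N\<close>, whereas \<open>l\<close> would grow like \<open>N\<close>.\<close>

lemma functional_not_frequently_ge:
  fixes \<Omega> :: "'a::euclidean_space set" and w :: "nat \<Rightarrow> 'a \<Rightarrow> real"
  assumes fm: "finite_measure (lebesgue_on \<Omega>)"
    and w_meas: "\<And>k. w k \<in> borel_measurable (lebesgue_on \<Omega>)"
    and w_bound: "\<And>k. AE x in lebesgue_on \<Omega>. \<bar>w k x\<bar> \<le> 1"
    and orth: "\<And>j. (\<lambda>k. LINT x|lebesgue_on \<Omega>. w j x * w k x) \<longlonglongrightarrow> 0"
    and p: "1 \<le> p" and l: "bounded_functional (Lp p \<Omega>) (Lp_norm p \<Omega>) l"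
    and \<eta>: "0 < \<eta>"
  shows "\<not> (\<exists>\<^sub>F k in sequentially. \<eta> \<le> l (w k))"
proof
  assume freq: "\<exists>\<^sub>F k in sequentially. \<eta> \<le> l (w k)"
  interpret finite_measure "lebesgue_on \<Omega>" by (rule fm)
  define V where "V = measure (lebesgue_on \<Omega>) (space (lebesgue_on \<Omega>))"
  have l_add: "l (f + g) = l f + l g" if "f \<in> Lp p \<Omega>" "g \<in> Lp p \<Omega>" for f g
    using l that by (simp add: bounded_functional_def)
  have l_scale: "l (c *\<^sub>R f) = c * l f" if "f \<in> Lp p \<Omega>" for c f
    using l that by (simp add: bounded_functional_def)
  have in_Lp: "f \<in> Lp p \<Omega>" if "f \<in> borel_measurable (lebesgue_on \<Omega>)" "AE x in lebesgue_on \<Omega>. \<bar>f x\<bar> \<le> a" for f a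
    using Lp_AE_bounded[OF fm that, of p] p by simp
  \<comment> \<open>The witness is a sum of \<open>n\<close> members of the sequence. The limit in
    the last conjunct drives the induction: it allows the next member to have product less than 1/2
    with \<open>s\<close>. Each step thus adds at most 1 for the doubled cross term and
    \<open>V\<close> for the new square, hence the factor \<open>V + 1\<close>.\<close>
  have sums: "\<exists>s. s \<in> borel_measurable (lebesgue_on \<Omega>) \<and> (AE x in lebesgue_on \<Omega>. \<bar>s x\<bar> \<le> real n) \<and>
      real n * \<eta> \<le> l s \<and> (LINT x|lebesgue_on \<Omega>. s x * s x) \<le> real n * (V + 1) \<and>
      (\<lambda>k. LINT x|lebesgue_on \<Omega>. s x * w k x) \<longlonglongrightarrow> 0" for n
  proof (induction n)
    case 0
    have "l (\<lambda>x. 0) = 0"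
      using l_scale[of "\<lambda>x. 0" 0] in_Lp[of "\<lambda>x. 0" 1] by (simp add: scaleR_fun_def)
    then show ?case by (intro exI[of _ "\<lambda>x. 0"]) simp
  next
    case (Suc n)
    then obtain s where s[measurable]: "s \<in> borel_measurable (lebesgue_on \<Omega>)"
      and s_bound: "AE x in lebesgue_on \<Omega>. \<bar>s x\<bar> \<le> real n" and s_l: "real n * \<eta> \<le> l s"
      and s_sq: "(LINT x|lebesgue_on \<Omega>. s x * s x) \<le> real n * (V + 1)"
      and s_orth: "(\<lambda>k. LINT x|lebesgue_on \<Omega>. s x * w k x) \<longlonglongrightarrow> 0" by blast
    have "eventually (\<lambda>k. (LINT x|lebesgue_on \<Omega>. s x * w k x) < 1 / 2) sequentially"
      using s_orth by (rule order_tendstoD) simp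
    then obtain k where k: "\<eta> \<le> l (w k)" "(LINT x|lebesgue_on \<Omega>. s x * w k x) < 1 / 2"
      using frequently_ex[OF frequently_eventually_frequently[OF freq]] by blast
    note w_meas[measurable]
    have i: "integrable (lebesgue_on \<Omega>) (\<lambda>x. s x * s x)" "integrable (lebesgue_on \<Omega>) (\<lambda>x. s x * w j x)"
      "integrable (lebesgue_on \<Omega>) (\<lambda>x. w i x * w j x)" for i j
      by (rule integrable_mult_AE_bounded; fact)+
    have wk: "(LINT x|lebesgue_on \<Omega>. w k x * w k x) \<le> V"
    proof -
      have "(LINT x|lebesgue_on \<Omega>. w k x * w k x) \<le> (LINT x|lebesgue_on \<Omega>. 1)"
      proof (rule integral_mono_AE)
        show "AE x in lebesgue_on \<Omega>. w k x * w k x \<le> 1"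
          using w_bound[of k] by eventually_elim (metis abs_mult_self_eq abs_ge_zero mult_le_one)
      qed (use i(3)[of k k] in simp_all)
      then show ?thesis by (simp add: V_def)
    qed
    show ?case
    proof (intro exI[of _ "s + w k"] conjI)
      show "s + w k \<in> borel_measurable (lebesgue_on \<Omega>)" unfolding plus_fun_def by measurable
      show "AE x in lebesgue_on \<Omega>. \<bar>(s + w k) x\<bar> \<le> real (Suc n)"
        using s_bound w_bound[of k] by eventually_elim (simp add: plus_fun_def)
      show "real (Suc n) * \<eta> \<le> l (s + w k)"
        using l_add[OF in_Lp[OF s s_bound] in_Lp[OF w_meas w_bound]] s_l k(1) by (simp add: algebra_simps)
      have "(LINT x|lebesgue_on \<Omega>. (s + w k) x * (s + w k) x)
          = (LINT x|lebesgue_on \<Omega>. s x * s x + 2 * (s x * w k x) + w k x * w k x)"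
        by (simp add: plus_fun_def algebra_simps)
      also have "\<dots> = (LINT x|lebesgue_on \<Omega>. s x * s x) + 2 * (LINT x|lebesgue_on \<Omega>. s x * w k x)
          + (LINT x|lebesgue_on \<Omega>. w k x * w k x)"
        using i(1) i(2)[of k] i(3)[of k k] by simp
      also have "\<dots> \<le> real (Suc n) * (V + 1)"
        using s_sq k(2) wk by (simp add: algebra_simps)
      finally show "(LINT x|lebesgue_on \<Omega>. (s + w k) x * (s + w k) x) \<le> real (Suc n) * (V + 1)" .
      have "(LINT x|lebesgue_on \<Omega>. (s + w k) x * w j x)
          = (LINT x|lebesgue_on \<Omega>. s x * w j x) + (LINT x|lebesgue_on \<Omega>. w k x * w j x)" for j
        using i(2)[of j] i(3)[of k j] by (simp add: plus_fun_def algebra_simps)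
      then show "(\<lambda>j. LINT x|lebesgue_on \<Omega>. (s + w k) x * w j x) \<longlonglongrightarrow> 0"
        using tendsto_add[OF s_orth orth[of k]] by simp
    qed
  qed
  define P where "P n s \<longleftrightarrow> s \<in> borel_measurable (lebesgue_on \<Omega>) \<and>
      (AE x in lebesgue_on \<Omega>. \<bar>s x\<bar> \<le> real n) \<and>
      real n * \<eta> \<le> l s \<and> (LINT x|lebesgue_on \<Omega>. s x * s x) \<le> real n * (V + 1)" for n s
  have "\<forall>n. \<exists>s. P n s"
    using sums unfolding P_def by fast
  then obtain s where "\<And>n. P n (s n)"
    using choice by blast
  then have s: "\<And>n. s n \<in> borel_measurable (lebesgue_on \<Omega>)"
      "\<And>n. AE x in lebesgue_on \<Omega>. \<bar>s n x\<bar> \<le> real n" "\<And>n. real n * \<eta> \<le> l (s n)"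
      "\<And>n. (LINT x|lebesgue_on \<Omega>. s n x * s n x) \<le> real n * (V + 1)"
    by (simp_all only: P_def)
  \<comment> \<open>Averaging keeps the value of \<open>l\<close> at least \<open>\<eta>\<close> and
    the bound 1, while the integral of the square drops to at most
    \<open>(V + 1) / real (Suc n)\<close>. The successor avoids an empty average.\<close>
  define m where "m n = (1 / real (Suc n)) *\<^sub>R s (Suc n)" for n
  have m_eq: "m n x = s (Suc n) x / real (Suc n)" for n x
    by (simp add: m_def scaleR_fun_def)
  have m_meas: "m n \<in> borel_measurable (lebesgue_on \<Omega>)" for n
    using s(1)[of "Suc n"] unfolding m_eq[abs_def] by measurable
  have m_bound: "AE x in lebesgue_on \<Omega>. \<bar>m n x\<bar> \<le> 1" for n
    using s(2)[of "Suc n"] by eventually_elim (simp add: m_eq abs_divide del: of_nat_Suc)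
  have m_l: "\<eta> \<le> l (m n)" for n
    using s(3)[of "Suc n"] l_scale[OF in_Lp[OF s(1)[of "Suc n"] s(2)]]
    by (simp add: m_def field_simps)
  have "(\<lambda>n. LINT x|lebesgue_on \<Omega>. m n x * m n x) \<longlonglongrightarrow> 0"
  proof (rule tendsto_sandwich)
    show "eventually (\<lambda>n. 0 \<le> (LINT x|lebesgue_on \<Omega>. m n x * m n x)) sequentially"
      by simp
    show "eventually (\<lambda>n. (LINT x|lebesgue_on \<Omega>. m n x * m n x) \<le> (V + 1) / real (Suc n)) sequentially"
    proof (rule always_eventually, rule allI)
      fix n
      have "(LINT x|lebesgue_on \<Omega>. m n x * m n x) = (LINT x|lebesgue_on \<Omega>. s (Suc n) x * s (Suc n) x) / (real (Suc n) * real (Suc n))"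
        by (simp add: m_eq del: of_nat_Suc)
      also have "\<dots> \<le> real (Suc n) * (V + 1) / (real (Suc n) * real (Suc n))"
        by (intro divide_right_mono s(4)) simp
      finally show "(LINT x|lebesgue_on \<Omega>. m n x * m n x) \<le> (V + 1) / real (Suc n)"
        by (simp del: of_nat_Suc)
    qed
    show "(\<lambda>n. (V + 1) / real (Suc n)) \<longlonglongrightarrow> 0"
      by (rule LIMSEQ_Suc[OF lim_const_over_n])
  qed simp
  then have "(\<lambda>n. Lp_norm p \<Omega> (m n)) \<longlonglongrightarrow> 0"
    by (rule Lp_norm_tendsto_zero[OF fm m_meas m_bound p])
  moreover obtain B where B: "\<And>f. f \<in> Lp p \<Omega> \<Longrightarrow> \<bar>l f\<bar> \<le> B * Lp_norm p \<Omega> f"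
    using l unfolding bounded_functional_def by blast
  ultimately have "(\<lambda>n. B * Lp_norm p \<Omega> (m n)) \<longlonglongrightarrow> 0"
    using tendsto_mult_right_zero by blast
  then have "eventually (\<lambda>n. B * Lp_norm p \<Omega> (m n) < \<eta>) sequentially"
    using \<eta> by (rule order_tendstoD)
  then obtain n where "B * Lp_norm p \<Omega> (m n) < \<eta>"
    using eventually_happens' sequentially_bot by blast
  then show False
    using B[OF in_Lp[OF m_meas m_bound], of n] m_l[of n] by linarith
qed

text \<open>The one-sided statement, applied to \<open>l\<close> and to \<open>- l\<close>, leaves
  only finitely many \<open>k\<close> at which the modulus of \<open>l (w k)\<close> is at least
  \<open>e\<close>.\<close>

lemma functional_tendsto_zero:
  fixes \<Omega> :: "'a::euclidean_space set" and w :: "nat \<Rightarrow> 'a \<Rightarrow> real"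
  assumes fm: "finite_measure (lebesgue_on \<Omega>)"
    and w_meas: "\<And>k. w k \<in> borel_measurable (lebesgue_on \<Omega>)"
    and w_bound: "\<And>k. AE x in lebesgue_on \<Omega>. \<bar>w k x\<bar> \<le> 1"
    and orth: "\<And>j. (\<lambda>k. LINT x|lebesgue_on \<Omega>. w j x * w k x) \<longlonglongrightarrow> 0"
    and p: "1 \<le> p" and l: "bounded_functional (Lp p \<Omega>) (Lp_norm p \<Omega>) l"
  shows "(\<lambda>k. l (w k)) \<longlonglongrightarrow> 0"
proof (rule tendstoI)
  fix e :: real assume e: "0 < e"
  have "bounded_functional (Lp p \<Omega>) (Lp_norm p \<Omega>) (\<lambda>f. - l f)"
    using l by (auto simp: bounded_functional_def)
  then have "eventually (\<lambda>k. \<not> e \<le> - l (w k)) sequentially" "eventually (\<lambda>k. \<not> e \<le> l (w k)) sequentially"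
    using functional_not_frequently_ge[OF fm w_meas w_bound orth p _ e] l
    by (auto simp: not_frequently)
  then show "eventually (\<lambda>k. dist (l (w k)) 0 < e) sequentially"
    by eventually_elim (auto simp: dist_real_def)
qed

section \<open>Construction of the weak limit\<close>

text \<open>Compactness of a product plays the part of a diagonal argument: for each
  \<open>k\<close> the function \<open>\<lambda>j. a j k\<close> is a point of a countable product
  of compact intervals, which is compact and metrizable, hence sequentially compact. Convergence
  there is coordinatewise.\<close>

lemma bounded_double_sequence_subsequence:
  fixes a :: "nat \<Rightarrow> nat \<Rightarrow> real"
  assumes "\<And>j k. a j k \<in> {b..c}"
  obtains r l where "strict_mono r" "\<And>j. (\<lambda>k. a j (r k)) \<longlonglongrightarrow> l j"
proof -
  have "compact (\<Pi>\<^sub>E j\<in>(UNIV :: nat set). {b..c})"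
    using compactin_PiE[of "\<lambda>_. euclidean" UNIV "\<lambda>_. {b..c}"]
    by (simp add: euclidean_product_topology)
  then have "seq_compact (\<Pi>\<^sub>E j\<in>(UNIV :: nat set). {b..c})"
    by (simp add: compact_eq_seq_compact_metric)
  moreover have "\<forall>k. (\<lambda>j. a j k) \<in> (\<Pi>\<^sub>E j\<in>(UNIV :: nat set). {b..c})"
    using assms by auto
  ultimately obtain l r where r: "strict_mono r" and lim: "((\<lambda>k j. a j k) \<circ> r) \<longlonglongrightarrow> l"
    by (rule seq_compactE)
  have "(\<lambda>k. (((\<lambda>k j. a j k) \<circ> r) k) j) \<longlonglongrightarrow> l j" for j
    by (rule continuous_on_tendsto_compose[OF continuous_on_product_coordinates lim]) simp_all
  then show ?thesis
    using that[OF r, of l] by simp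
qed

text \<open>The last conclusion is the almost orthogonality that
  \<open>functional_tendsto_zero\<close> demands of the differences \<open>f (r k) - g\<close>. It
  only involves the limits of the pairings of \<open>u j\<close> and of \<open>g\<close> with
  \<open>u k\<close>, so the proof amounts to identifying these two limits.\<close>

lemma (in finite_measure) weak_limit_exists:
  fixes f :: "nat \<Rightarrow> 'a \<Rightarrow> real"
  assumes f_meas: "\<And>k. f k \<in> borel_measurable M"
    and f_box: "\<And>k. AE x in M. 0 \<le> f k x \<and> f k x \<le> 1"
  obtains r g where "strict_mono r" "g \<in> borel_measurable M" "AE x in M. 0 \<le> g x \<and> g x \<le> 1"
    "\<And>j. (\<lambda>k. LINT x|M. (f (r j) x - g x) * (f (r k) x - g x)) \<longlonglongrightarrow> 0"
proof -
  define V where "V = measure M (space M)"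
  define D where "D = {h \<in> borel_measurable M. AE x in M. 0 \<le> h x \<and> h x \<le> (1 :: real)}"
  define ip where "ip u v = (LINT x|M. u x * v x)" for u v :: "'a \<Rightarrow> real"
  have D_meas[measurable_dest]: "h \<in> borel_measurable M" if "h \<in> D" for h
    using that by (simp add: D_def)
  have D_abs: "AE x in M. \<bar>h x\<bar> \<le> 1" if "h \<in> D" for h
    using that by (auto simp: D_def elim: eventually_mono)
  have fD: "f k \<in> D" for k using f_meas f_box by (simp add: D_def)
  have D_int: "integrable M (\<lambda>x. u x * v x)" if "u \<in> D" "v \<in> D" for u v
    using integrable_mult_AE_bounded[OF D_meas D_meas D_abs D_abs] that by blast
  have ip_commute: "ip u v = ip v u" for u v by (simp add: ip_def mult.commute)
  have ip_bounds: "ip u v \<in> {0..V}" if "u \<in> D" "v \<in> D" for u v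
  proof -
    have ae: "AE x in M. 0 \<le> u x * v x \<and> u x * v x \<le> 1"
      using that unfolding D_def mem_Collect_eq
      by (elim conjE) (rule AE_mp[where P = "\<lambda>x. 0 \<le> u x \<and> u x \<le> 1"], assumption,
        erule eventually_mono, auto intro: mult_le_one)
    then have "0 \<le> ip u v" unfolding ip_def by (intro integral_nonneg_AE) auto
    moreover have "ip u v \<le> (LINT x|M. 1)"
      unfolding ip_def using ae D_int[OF that] by (intro integral_mono_AE) auto
    ultimately show ?thesis by (simp add: V_def)
  qed
  have D_comb: "a *\<^sub>R u + b *\<^sub>R v \<in> D" if "u \<in> D" "v \<in> D" "0 \<le> a" "0 \<le> b" "a + b = 1" for u v and a b :: real
  proof -
    have "AE x in M. 0 \<le> u x \<and> u x \<le> 1" "AE x in M. 0 \<le> v x \<and> v x \<le> 1"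
      using that by (auto simp: D_def)
    then have "AE x in M. 0 \<le> a * u x + b * v x \<and> a * u x + b * v x \<le> 1"
      by eventually_elim (use that in \<open>auto intro: convex_bound_le\<close>)
    moreover have "(\<lambda>x. a * u x + b * v x) \<in> borel_measurable M"
      using that by measurable
    ultimately show ?thesis by (simp add: D_def scaleR_fun_def plus_fun_def)
  qed
  have ip_comb: "ip (a *\<^sub>R u + b *\<^sub>R v) h = a * ip u h + b * ip v h" if "u \<in> D" "v \<in> D" "h \<in> D" for u v h a b
  proof -
    have "ip (a *\<^sub>R u + b *\<^sub>R v) h = (LINT x|M. a * (u x * h x) + b * (v x * h x))"
      by (simp add: ip_def scaleR_fun_def plus_fun_def algebra_simps)
    also have "\<dots> = a * ip u h + b * ip v h"
      using D_int that by (simp add: ip_def)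
    finally show ?thesis .
  qed
  have ip_comb': "ip h (a *\<^sub>R u + b *\<^sub>R v) = a * ip h u + b * ip h v" if "u \<in> D" "v \<in> D" "h \<in> D" for u v h a b
    using ip_comb[OF that] by (simp add: ip_commute[of h])
  have diff_abs: "AE x in M. \<bar>u x - v x\<bar> \<le> 1" if "u \<in> D" "v \<in> D" for u v
  proof -
    have "AE x in M. 0 \<le> u x \<and> u x \<le> 1" "AE x in M. 0 \<le> v x \<and> v x \<le> 1"
      using that by (auto simp: D_def)
    then show ?thesis by eventually_elim auto
  qed
  have ip_diff: "(LINT x|M. (u x - v x) * (w x - z x)) = ip u w - ip u z - ip v w + ip v z"
    if "u \<in> D" "v \<in> D" "w \<in> D" "z \<in> D" for u v w z
  proof -
    have "(LINT x|M. (u x - v x) * (w x - z x)) = (LINT x|M. u x * w x - u x * z x - v x * w x + v x * z x)"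
      by (simp add: algebra_simps)
    also have "\<dots> = ip u w - ip u z - ip v w + ip v z"
      using D_int that by (simp add: ip_def)
    finally show ?thesis .
  qed
  \<comment> \<open>Since members of \<open>D\<close> are bounded by 1, L^1 convergence suffices to
    pass to the limit in a pairing.\<close>
  have ip_L1: "\<bar>ip u h - ip v h\<bar> \<le> (LINT x|M. \<bar>u x - v x\<bar>)" if "u \<in> D" "v \<in> D" "h \<in> D" for u v h
  proof -
    have i: "integrable M (\<lambda>x. u x - v x)"
      using that diff_abs[OF that(1,2)] by (intro integrable_AE_bounded[where a = 1]) auto
    have "ip u h - ip v h = (LINT x|M. (u x - v x) * h x)"
      using D_int that by (simp add: ip_def left_diff_distrib)
    also have "\<bar>\<dots>\<bar> \<le> (LINT x|M. \<bar>(u x - v x) * h x\<bar>)"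
      by (rule integral_abs_bound)
    also have "\<dots> \<le> (LINT x|M. \<bar>u x - v x\<bar>)"
    proof (rule integral_mono_AE)
      show "integrable M (\<lambda>x. \<bar>(u x - v x) * h x\<bar>)"
        using D_int that by (simp add: left_diff_distrib)
      show "AE x in M. \<bar>(u x - v x) * h x\<bar> \<le> \<bar>u x - v x\<bar>"
        using D_abs[OF that(3)] by eventually_elim (simp add: abs_mult mult_left_le)
    qed (use i in simp)
    finally show ?thesis .
  qed

  \<comment> \<open>The index \<open>j\<close> runs over the original sequence, so the limit of the
    pairings with \<open>u j = f (r j)\<close> is \<open>c (r j)\<close>.\<close>
  obtain r c where r: "strict_mono r" and c: "\<And>j. (\<lambda>k. ip (f j) (f (r k))) \<longlonglongrightarrow> c j"
    using bounded_double_sequence_subsequence[of "\<lambda>j k. ip (f j) (f k)" 0 V] ip_bounds[OF fD fD] by blast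
  define u where "u k = f (r k)" for k
  have uD: "u k \<in> D" for k by (simp add: u_def fD)

  define H where "H n = convex hull (u ` {n..})" for n
  have convex_D: "convex D" by (intro convexI D_comb)
  have HD: "H n \<subseteq> D" for n
    unfolding H_def by (rule hull_minimal) (use uD convex_D in auto)
  have H_mono: "H m \<subseteq> H n" if "n \<le> m" for n m
    unfolding H_def using that by (intro hull_mono image_mono) auto
  have H_ne: "H n \<noteq> {}" for n by (auto simp: H_def)
  \<comment> \<open>The infima increase because the hulls shrink, and they are bounded by
    \<open>V\<close>. Their convergence is what makes the almost minimal elements \<open>y n\<close>
    a Cauchy sequence.\<close>
  define d where "d n = Inf ((\<lambda>h. ip h h) ` H n)" for n
  have bdd: "bdd_below ((\<lambda>h. ip h h) ` H n)" for n
    using ip_bounds HD by (auto intro!: bdd_belowI2[where m = 0])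
  have d_le: "d n \<le> ip h h" if "h \<in> H n" for n h
    unfolding d_def using that bdd by (auto intro: cInf_lower)
  have "\<exists>h. h \<in> H n \<and> ip h h < d n + inverse (real (Suc n))" for n
    using cInf_lessD[of "(\<lambda>h. ip h h) ` H n" "d n + inverse (real (Suc n))"] H_ne
    by (auto simp: d_def)
  then obtain y where yH: "\<And>n. y n \<in> H n" and y: "\<And>n. ip (y n) (y n) < d n + inverse (real (Suc n))"
    by metis
  have yD: "y n \<in> D" for n using yH HD by blast
  have d_mono: "d n \<le> d m" if "n \<le> m" for n m
    unfolding d_def using H_ne H_mono[OF that] bdd by (intro cInf_superset_mono) auto
  have d_V: "d n \<le> V" for n
    using d_le[OF yH] ip_bounds[OF yD yD] by (meson atLeastAtMost_iff order_trans)
  have "incseq d" using d_mono by (auto simp: incseq_def)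
  then obtain dlim where dlim: "d \<longlonglongrightarrow> dlim" and d_dlim: "\<And>n. d n \<le> dlim"
    using incseq_convergent[of d V] d_V by auto
  \<comment> \<open>The midpoint of \<open>y i\<close> and \<open>y j\<close> lies in
    \<open>H n\<close>, so its squared norm is at least \<open>d n\<close>. The squared distance is
    twice the sum of the two squared norms, each at most
    \<open>dlim + inverse (real (Suc n))\<close>, minus four times the squared norm of the
    midpoint.\<close>
  have parallelogram: "(LINT x|M. (y i x - y j x) * (y i x - y j x))
      \<le> 4 * (dlim - d n) + 4 * inverse (real (Suc n))" if "n \<le> i" "n \<le> j" for i j n
  proof -
    let ?m = "(1/2) *\<^sub>R y i + (1/2) *\<^sub>R y j"
    have "?m \<in> H n"
      using yH[of i] yH[of j] H_mono that convex_convex_hull[of "u ` {n..}", THEN convexD, of "y i" "y j" "1/2" "1/2"]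
      unfolding H_def[symmetric] by auto
    then have "d n \<le> ip ?m ?m" by (rule d_le)
    also have "ip ?m ?m = (ip (y i) (y i) + 2 * ip (y i) (y j) + ip (y j) (y j)) / 4"
      using D_comb[OF yD yD, of "1/2" "1/2" i j]
      by (simp add: ip_comb ip_comb' yD ip_commute[of "y j" "y i"] field_simps)
    finally have m: "4 * d n \<le> ip (y i) (y i) + 2 * ip (y i) (y j) + ip (y j) (y j)" by simp
    have inv: "inverse (real (Suc i)) \<le> inverse (real (Suc n))" "inverse (real (Suc j)) \<le> inverse (real (Suc n))"
      using that by (auto intro: le_imp_inverse_le)
    have q: "ip (y i) (y i) \<le> dlim + inverse (real (Suc n))" "ip (y j) (y j) \<le> dlim + inverse (real (Suc n))"
      using inv y[of i] y[of j] d_dlim[of i] d_dlim[of j] by linarith+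
    have "(LINT x|M. (y i x - y j x) * (y i x - y j x)) = ip (y i) (y i) - 2 * ip (y i) (y j) + ip (y j) (y j)"
      using ip_diff[OF yD yD yD yD, of i j i j] ip_commute[of "y j" "y i"] by simp
    also have "\<dots> \<le> 4 * (dlim - d n) + 4 * inverse (real (Suc n))"
      using m q by argo
    finally show ?thesis .
  qed
  have bound_lim: "(\<lambda>n. 4 * (dlim - d n) + 4 * inverse (real (Suc n))) \<longlonglongrightarrow> 0"
    using tendsto_add[OF tendsto_mult_left[OF tendsto_diff[OF tendsto_const dlim]]
        tendsto_mult_left[OF LIMSEQ_inverse_real_of_nat], of 4 dlim 4] by simp
  have "((\<lambda>(i, j). LINT x|M. (y i x - y j x) * (y i x - y j x)) \<longlongrightarrow> 0) (sequentially \<times>\<^sub>F sequentially)"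
  proof (rule tendstoI)
    fix e :: real assume "0 < e"
    then obtain n where n: "4 * (dlim - d n) + 4 * inverse (real (Suc n)) < e"
      using order_tendstoD(2)[OF bound_lim, of e] eventually_happens' sequentially_bot by blast
    show "eventually (\<lambda>ij. dist (case ij of (i, j) \<Rightarrow> LINT x|M. (y i x - y j x) * (y i x - y j x)) 0 < e)
      (sequentially \<times>\<^sub>F sequentially)"
      unfolding eventually_prod_sequentially
    proof (intro exI[of _ n] allI impI)
      fix i j assume ij: "n \<le> i" "n \<le> j"
      have "0 \<le> (LINT x|M. (y j x - y i x) * (y j x - y i x))" by simp
      then show "dist (case (j, i) of (i, j) \<Rightarrow> LINT x|M. (y i x - y j x) * (y i x - y j x)) 0 < e"
        using parallelogram[OF ij(2,1)] n by (simp add: dist_real_def del: integral_nonneg)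
    qed
  qed
  \<comment> \<open>The exponent 1 turns the L^2 Cauchy property into an L^1 one, the form from
    which \<open>cauchy_L1_AE_cauchy_subseq\<close> extracts an almost everywhere Cauchy
    subsequence.\<close>
  then have L: "((\<lambda>ij. LINT x|M. \<bar>y (fst ij) x - y (snd ij) x\<bar> powr 1) \<longlongrightarrow> 0) (sequentially \<times>\<^sub>F sequentially)"
    using yD diff_abs[OF yD yD]
    by (intro integral_powr_tendsto_zero) (auto simp: case_prod_unfold)
  have L1: "\<exists>N. \<forall>i\<ge>N. \<forall>j\<ge>N. (LINT x|M. norm (y i x - y j x)) < e" if "0 < e" for e
    using order_tendstoD(2)[OF L that] unfolding eventually_prod_sequentially by simp blast
  have y_int: "integrable M (y n)" for n
    using D_meas[OF yD] D_abs[OF yD] by (rule integrable_AE_bounded)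
  obtain s where s: "strict_mono s" and cau: "AE x in M. Cauchy (\<lambda>i. y (s i) x)"
    using cauchy_L1_AE_cauchy_subseq[OF y_int L1] by blast
  \<comment> \<open>On the null set where the sequence may diverge, \<open>lim\<close> takes an
    unspecified value; \<open>g\<close> is measurable all the same.\<close>
  define g where "g x = lim (\<lambda>i. y (s i) x)" for x
  have g_meas: "g \<in> borel_measurable M"
    unfolding g_def[abs_def] using D_meas[OF yD] by (intro borel_measurable_lim_metric)
  have g_lim: "AE x in M. (\<lambda>i. y (s i) x) \<longlonglongrightarrow> g x"
    using cau by eventually_elim (simp add: g_def Cauchy_convergent_iff convergent_LIMSEQ_iff)
  have "AE x in M. \<forall>i. 0 \<le> y (s i) x \<and> y (s i) x \<le> 1"
    using yD by (simp add: AE_all_countable D_def)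
  with g_lim have "AE x in M. 0 \<le> g x \<and> g x \<le> 1"
    by eventually_elim (auto intro: LIMSEQ_le_const LIMSEQ_le_const2)
  then have gD: "g \<in> D" using g_meas by (simp add: D_def)
  have g_L1: "(\<lambda>i. LINT x|M. \<bar>y (s i) x - g x\<bar>) \<longlonglongrightarrow> 0"
  proof -
    have "(\<lambda>i. LINT x|M. \<bar>y (s i) x - g x\<bar>) \<longlonglongrightarrow> (LINT x|M. 0)"
    proof (rule integral_dominated_convergence[where w = "\<lambda>_. 1"])
      show "(\<lambda>x. \<bar>y (s i) x - g x\<bar>) \<in> borel_measurable M" for i
        using g_meas D_meas[OF yD[of "s i"]] by measurable
      show "AE x in M. (\<lambda>i. \<bar>y (s i) x - g x\<bar>) \<longlonglongrightarrow> 0"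
        using g_lim by eventually_elim (simp add: tendsto_rabs_zero_iff LIM_zero_iff)
      show "AE x in M. norm \<bar>y (s i) x - g x\<bar> \<le> 1" for i
        using diff_abs[OF yD gD, of "s i"] by simp
    qed auto
    then show ?thesis by simp
  qed
  have ip_y: "(\<lambda>i. ip (y (s i)) h) \<longlonglongrightarrow> ip g h" if "h \<in> D" for h
    by (rule LIM_zero_cancel, rule Lim_null_comparison[OF _ g_L1])
      (use ip_L1[OF yD gD that] in auto)
  have g_u: "ip g (u j) = c (r j)" for j
  proof (rule LIMSEQ_unique[OF ip_y[OF uD]], rule tendstoI)
    fix e :: real assume e: "0 < e"
    \<comment> \<open>This set is convex and contains \<open>u k\<close> for all large
      \<open>k\<close>. It therefore contains the hull \<open>H n\<close> of a tail, and with it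
      \<open>y (s i)\<close> for all \<open>i\<close> from \<open>n\<close> on, since
      \<open>i \<le> s i\<close>.\<close>
    let ?B = "{h \<in> D. \<bar>ip (u j) h - c (r j)\<bar> \<le> e / 2}"
    have "(\<lambda>k. ip (u j) (u k)) \<longlonglongrightarrow> c (r j)"
      using c[of "r j"] by (simp add: u_def)
    then obtain n where n: "\<And>k. n \<le> k \<Longrightarrow> \<bar>ip (u j) (u k) - c (r j)\<bar> < e / 2"
      using e by (metis LIMSEQ_D half_gt_zero real_norm_def)
    have "convex ?B"
    proof (rule convexI)
      fix h k and a b :: real
      assume hk: "h \<in> ?B" "k \<in> ?B" and ab: "0 \<le> a" "0 \<le> b" "a + b = 1"
      have "ip (u j) (a *\<^sub>R h + b *\<^sub>R k) - c (r j)
          = a * (ip (u j) h - c (r j)) + b * (ip (u j) k - c (r j))"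
        using hk ab uD by (simp add: ip_comb' algebra_simps flip: distrib_right)
      also have "\<bar>\<dots>\<bar> \<le> a * \<bar>ip (u j) h - c (r j)\<bar> + b * \<bar>ip (u j) k - c (r j)\<bar>"
        using ab by (metis abs_mult abs_of_nonneg abs_triangle_ineq)
      also have "\<dots> \<le> e / 2"
        using hk ab by (intro convex_bound_le) auto
      finally show "a *\<^sub>R h + b *\<^sub>R k \<in> ?B" using D_comb hk ab by simp
    qed
    then have HB: "H n \<subseteq> ?B"
      unfolding H_def by (intro hull_minimal) (use n uD in \<open>auto intro: less_imp_le\<close>)
    have "eventually (\<lambda>i. n \<le> i) sequentially" by (rule eventually_ge_at_top)
    then show "eventually (\<lambda>i. dist (ip (y (s i)) (u j)) (c (r j)) < e) sequentially"
    proof eventually_elim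
      case (elim i)
      then have "y (s i) \<in> ?B"
        using yH H_mono HB seq_suble[OF s, of i] by (meson in_mono order_trans)
      then show ?case using e by (simp add: dist_real_def ip_commute[of "y (s i)"])
    qed
  qed
  \<comment> \<open>The property is preserved by convex combinations, so it is enough to check the
    generators \<open>u j\<close>. There it holds because both \<open>ip g (u j)\<close> and the
    limit of the pairings equal \<open>c (r j)\<close>.\<close>
  have u_H: "(\<lambda>k. ip h (u k)) \<longlonglongrightarrow> ip h g" if "h \<in> H 0" for h
  proof -
    let ?B = "{h \<in> D. (\<lambda>k. ip h (u k)) \<longlonglongrightarrow> ip h g}"
    have "convex ?B"
      by (rule convexI) (auto simp: ip_comb uD gD intro!: D_comb tendsto_intros)
    moreover have "u j \<in> ?B" for j
      using c[of "r j"] g_u[of j] uD by (simp add: u_def ip_commute)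
    ultimately have "H 0 \<subseteq> ?B"
      unfolding H_def by (intro hull_minimal) auto
    with that show ?thesis by blast
  qed
  \<comment> \<open>Three errors of size \<open>e / 3\<close>: \<open>g\<close> is replaced by some
    \<open>y (s i)\<close> in \<open>H 0\<close> that is close in L^1, the limit is taken for that
    element, and \<open>g\<close> is put back.\<close>
  have u_g: "(\<lambda>k. ip g (u k)) \<longlonglongrightarrow> ip g g"
  proof (rule tendstoI)
    fix e :: real assume e: "0 < e"
    then have "eventually (\<lambda>i. (LINT x|M. \<bar>y (s i) x - g x\<bar>) < e / 3) sequentially"
      by (intro order_tendstoD(2)[OF g_L1]) simp
    then obtain i where i: "(LINT x|M. \<bar>y (s i) x - g x\<bar>) < e / 3"
      using eventually_happens' sequentially_bot by blast
    have "y (s i) \<in> H 0" using yH H_mono[of 0 "s i"] by blast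
    from u_H[OF this] have "eventually (\<lambda>k. dist (ip (y (s i)) (u k)) (ip (y (s i)) g) < e / 3) sequentially"
      using e by (intro tendstoD) auto
    then show "eventually (\<lambda>k. dist (ip g (u k)) (ip g g) < e) sequentially"
    proof eventually_elim
      case (elim k)
      then show ?case
        using i ip_L1[OF yD gD uD, of "s i" k] ip_L1[OF yD gD gD, of "s i"] unfolding dist_real_def
        by linarith
    qed
  qed
  have "(\<lambda>k. LINT x|M. (u j x - g x) * (u k x - g x)) \<longlonglongrightarrow> 0" for j
  proof -
    have "(\<lambda>k. ip (u j) (u k)) \<longlonglongrightarrow> ip (u j) g"
      using c[of "r j"] g_u[of j] by (simp add: u_def ip_commute)
    then have "(\<lambda>k. ip (u j) (u k) - ip (u j) g - ip g (u k) + ip g g)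
        \<longlonglongrightarrow> ip (u j) g - ip (u j) g - ip g g + ip g g"
      by (intro tendsto_intros u_g)
    then show ?thesis by (simp add: ip_diff uD gD)
  qed
  then show ?thesis
    using that[OF r g_meas] gD by (simp add: u_def D_def)
qed

section \<open>Measurability of the update and admissibility of the iterates\<close>

text \<open>Measurability of the update requires control of \<open>inv sigmoid\<close> on the whole
  line. A number outside the open unit interval has no preimage, so the choice predicate is
  constantly false and all such numbers receive the same unspecified value.\<close>

lemma inv_sigmoid_eq:
  "inv sigmoid t = (if 0 < t \<and> t < 1 then ln (t / (1 - t)) else (SOME x. False))"
proof (cases "0 < t \<and> t < 1")
  case True
  have "sigmoid x = t \<longleftrightarrow> x = ln (t / (1 - t))" for x
  proof
    assume "sigmoid x = t"
    then have "exp x = t / (1 - t)"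
      using True by (auto simp: sigmoid_def exp_minus field_simps add_pos_pos add_nonneg_eq_0_iff split: if_splits)
    then show "x = ln (t / (1 - t))" by (metis ln_exp)
  next
    assume x: "x = ln (t / (1 - t))"
    have "1 + exp (- x) = 1 / t"
      using True by (simp add: x exp_minus field_simps)
    then show "sigmoid x = t"
      by (simp add: sigmoid_def)
  qed
  then show ?thesis using True by (simp add: inv_into_def)
next
  case False
  have "sigmoid x \<noteq> t" for x
  proof
    assume "sigmoid x = t"
    then have "0 < t \<and> t < 1"
      by (auto simp: sigmoid_def add_pos_pos field_simps)
    with False show False by simp
  qed
  then show ?thesis using False by (simp only: inv_into_def UNIV_I simp_thms if_False)
qed

lemma borel_measurable_inv_sigmoid [measurable]: "inv sigmoid \<in> borel_measurable borel"
  unfolding inv_sigmoid_eq[abs_def] by measurable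

lemma borel_measurable_sigmoid [measurable]: "sigmoid \<in> borel_measurable borel"
  unfolding sigmoid_def[abs_def] by measurable

lemma sigmoid_in_unit_interval: "0 \<le> sigmoid t" "sigmoid t \<le> 1"
  by (auto simp: sigmoid_def add_pos_pos field_simps)

text \<open>Completeness of Lebesgue measure, carried over to the restricted space by extending
  functions by zero. It is needed because \<open>simpl_step\<close> fixes the next iterate only
  almost everywhere.\<close>

lemma borel_measurable_lebesgue_on_AE:
  fixes f g :: "'a::euclidean_space \<Rightarrow> real"
  assumes S: "S \<in> sets lebesgue" and f: "f \<in> borel_measurable (lebesgue_on S)"
    and ae: "AE x in lebesgue_on S. f x = g x"
  shows "g \<in> borel_measurable (lebesgue_on S)"
proof -
  have "(\<lambda>x. indicator S x *\<^sub>R f x) \<in> borel_measurable lebesgue"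
    using f S by (simp add: borel_measurable_restrict_space_iff)
  moreover have "AE x in lebesgue. indicator S x *\<^sub>R f x = indicator S x *\<^sub>R g x"
    using ae S by (auto simp: AE_restrict_space_iff indicator_def elim!: eventually_mono)
  ultimately have "(\<lambda>x. indicator S x *\<^sub>R g x) \<in> borel_measurable lebesgue"
    by (rule borel_measurable_AE)
  then show ?thesis
    using S by (simp add: borel_measurable_restrict_space_iff)
qed

lemma admissibleI:
  assumes f: "f \<in> borel_measurable (lebesgue_on \<Omega>)" and box: "AE x in lebesgue_on \<Omega>. 0 \<le> f x \<and> f x \<le> 1"
    and mass: "(LINT x|lebesgue_on \<Omega>. f x) = \<theta> * measure lebesgue \<Omega>"
  shows "f \<in> admissible \<theta> \<Omega>"
proof -
  have "esssup (lebesgue_on \<Omega>) (\<lambda>x. ereal \<bar>f x\<bar>) \<le> 1"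
    using f box by (intro esssup_I) (auto elim: eventually_mono)
  then have "f \<in> Linf \<Omega>"
    using f by (auto simp: Linf_def intro: le_less_trans)
  then show ?thesis
    using box mass by (simp add: admissible_def mass_constraint_def box_constraint_def)
qed

lemma admissibleD:
  assumes "f \<in> admissible \<theta> \<Omega>"
  shows "f \<in> borel_measurable (lebesgue_on \<Omega>)" "AE x in lebesgue_on \<Omega>. 0 \<le> f x \<and> f x \<le> 1"
    "(LINT x|lebesgue_on \<Omega>. f x) = \<theta> * measure lebesgue \<Omega>"
  using assms by (auto simp: admissible_def Linf_def mass_constraint_def box_constraint_def)

lemma int_admissible_subset: "int_admissible \<theta> \<Omega> \<subseteq> admissible \<theta> \<Omega>"
proof
  fix f assume f: "f \<in> int_admissible \<theta> \<Omega>"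
  then have box: "- esssup (lebesgue_on \<Omega>) (\<lambda>x. - ereal (f x)) > 0" "esssup (lebesgue_on \<Omega>) (\<lambda>x. ereal (f x)) < 1"
    by (auto simp: int_admissible_def int_box_def)
  have "AE x in lebesgue_on \<Omega>. - ereal (f x) \<le> esssup (lebesgue_on \<Omega>) (\<lambda>x. - ereal (f x))"
    "AE x in lebesgue_on \<Omega>. ereal (f x) \<le> esssup (lebesgue_on \<Omega>) (\<lambda>x. ereal (f x))"
    by (rule esssup_AE)+
  then have "AE x in lebesgue_on \<Omega>. 0 \<le> f x \<and> f x \<le> 1"
  proof eventually_elim
    case (elim x)
    have "esssup (lebesgue_on \<Omega>) (\<lambda>x. - ereal (f x)) < 0"
      using box(1) unfolding ereal_less_uminus_reorder by simp
    with elim(1) have "- ereal (f x) < 0" by (rule order_le_less_trans)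
    moreover have "ereal (f x) < 1"
      using elim(2) box(2) by (rule order_le_less_trans)
    ultimately show ?case by simp
  qed
  then show "f \<in> admissible \<theta> \<Omega>"
    using f by (intro admissibleI) (auto simp: int_admissible_def Linf_def mass_constraint_def)
qed

text \<open>The range of \<open>sigmoid\<close> yields the box constraint for every argument, and
  the equation that determines the multiplier yields the mass.\<close>

lemma simpl_step_admissible:
  assumes \<Omega>: "\<Omega> \<in> sets lebesgue" and r: "r \<in> admissible \<theta> \<Omega>" and g: "g \<in> Linf \<Omega>"
    and step: "simpl_step \<Omega> \<theta> \<alpha> g r r'"
  shows "r' \<in> admissible \<theta> \<Omega>"
proof -
  obtain \<mu> where mass: "(LINT x|lebesgue_on \<Omega>. sigmoid (inv sigmoid (r x) - \<alpha> * g x - \<mu>)) = \<theta> * measure lebesgue \<Omega>"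
    and ae: "AE x in lebesgue_on \<Omega>. r' x = sigmoid (inv sigmoid (r x) - \<alpha> * g x - \<mu>)"
    using step by (auto simp: simpl_step_def)
  define h where "h x = sigmoid (inv sigmoid (r x) - \<alpha> * g x - \<mu>)" for x
  have [measurable]: "r \<in> borel_measurable (lebesgue_on \<Omega>)" "g \<in> borel_measurable (lebesgue_on \<Omega>)"
    using admissibleD(1)[OF r] g by (auto simp: Linf_def)
  have h: "h \<in> borel_measurable (lebesgue_on \<Omega>)"
    unfolding h_def[abs_def] by measurable
  have ae': "AE x in lebesgue_on \<Omega>. h x = r' x"
    using ae by (auto simp: h_def)
  then have r': "r' \<in> borel_measurable (lebesgue_on \<Omega>)"
    by (rule borel_measurable_lebesgue_on_AE[OF \<Omega> h])
  have "(LINT x|lebesgue_on \<Omega>. h x) = (LINT x|lebesgue_on \<Omega>. r' x)"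
    by (rule integral_cong_AE[OF h r' ae'])
  moreover have "AE x in lebesgue_on \<Omega>. 0 \<le> r' x \<and> r' x \<le> 1"
    using ae by eventually_elim (simp add: sigmoid_in_unit_interval)
  ultimately show ?thesis
    using mass r' by (intro admissibleI) (simp_all add: h_def)
qed

section \<open>Modes of convergence along the index set of a subsequence\<close>

lemma tendsto_along_range:
  assumes r: "strict_mono r" and lim: "(\<lambda>k. h (r k)) \<longlonglongrightarrow> L"
  shows "(h \<longlongrightarrow> L) (along (range r))"
proof (rule topological_tendstoI)
  fix S assume "open S" "L \<in> S"
  from topological_tendstoD[OF lim this] obtain N where N: "\<And>k. N \<le> k \<Longrightarrow> h (r k) \<in> S"
    by (auto simp: eventually_sequentially)
  \<comment> \<open>Such an \<open>n\<close> is some \<open>r k\<close>, and strict monotonicity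
    turns \<open>r N \<le> r k\<close> into \<open>N \<le> k\<close>.\<close>
  have "h n \<in> S" if "r N \<le> n" "n \<in> range r" for n
    using that N strict_mono_less_eq[OF r] by auto
  then show "eventually (\<lambda>n. h n \<in> S) (along (range r))"
    unfolding along_def eventually_inf_principal eventually_sequentially by blast
qed

lemma infinite_range_strict_mono: "strict_mono (r :: nat \<Rightarrow> nat) \<Longrightarrow> infinite (range r)"
  by (meson range_inj_infinite strict_mono_imp_inj_on)

lemma weakly_converges_Lp_rangeI:
  fixes \<Omega> :: "'a::euclidean_space set"
  assumes fm: "finite_measure (lebesgue_on \<Omega>)" and r: "strict_mono r"
    and f_meas: "\<And>k. f k \<in> borel_measurable (lebesgue_on \<Omega>)"
    and f_box: "\<And>k. AE x in lebesgue_on \<Omega>. 0 \<le> f k x \<and> f k x \<le> 1"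
    and g_meas: "g \<in> borel_measurable (lebesgue_on \<Omega>)"
    and g_box: "AE x in lebesgue_on \<Omega>. 0 \<le> g x \<and> g x \<le> 1"
    and orth: "\<And>j. (\<lambda>k. LINT x|lebesgue_on \<Omega>. (f (r j) x - g x) * (f (r k) x - g x)) \<longlonglongrightarrow> 0"
    and p: "1 \<le> p"
  shows "weakly_converges_Lp p \<Omega> (range r) f g"
proof -
  define w where "w k = f (r k) - g" for k
  have w_eq: "w k x = f (r k) x - g x" for k x by (simp add: w_def fun_diff_def)
  have w_meas: "w k \<in> borel_measurable (lebesgue_on \<Omega>)" for k
    using f_meas[of "r k"] g_meas unfolding w_eq[abs_def] by measurable
  have w_bound: "AE x in lebesgue_on \<Omega>. \<bar>w k x\<bar> \<le> 1" for k
    using f_box[of "r k"] g_box by eventually_elim (auto simp: w_eq)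
  have orth': "(\<lambda>k. LINT x|lebesgue_on \<Omega>. w j x * w k x) \<longlonglongrightarrow> 0" for j
    using orth by (simp add: w_eq)
  have in_Lp: "h \<in> Lp p \<Omega>" if "h \<in> borel_measurable (lebesgue_on \<Omega>)" "AE x in lebesgue_on \<Omega>. \<bar>h x\<bar> \<le> 1" for h
    using Lp_AE_bounded[OF fm that, of p] p by simp
  have f_Lp: "f k \<in> Lp p \<Omega>" for k
    using f_meas f_box[of k] by (intro in_Lp) (auto elim: eventually_mono)
  have g_Lp: "g \<in> Lp p \<Omega>"
    using g_meas g_box by (intro in_Lp) (auto elim: eventually_mono)
  have "((\<lambda>k. l (f k)) \<longlongrightarrow> l g) (along (range r))"
    if l: "bounded_functional (Lp p \<Omega>) (Lp_norm p \<Omega>) l" for l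
  proof (rule tendsto_along_range[OF r])
    have "l (f (r k)) = l (w k) + l g" for k
    proof -
      have "f (r k) = w k + g" by (simp add: w_def)
      then show ?thesis
        using l in_Lp[OF w_meas w_bound, of k] g_Lp by (simp add: bounded_functional_def)
    qed
    then show "(\<lambda>k. l (f (r k))) \<longlonglongrightarrow> l g"
      using tendsto_add[OF functional_tendsto_zero[OF fm w_meas w_bound orth' p l] tendsto_const[of "l g"]]
      by simp
  qed
  then show ?thesis using f_Lp g_Lp by (simp add: weakly_converges_Lp_def)
qed

lemma weakly_converges_LpD:
  assumes "weakly_converges_Lp p \<Omega> K f g" "bounded_functional (Lp p \<Omega>) (Lp_norm p \<Omega>) l"
  shows "((\<lambda>k. l (f k)) \<longlongrightarrow> l g) (along K)"
  using assms unfolding weakly_converges_Lp_def by blast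

text \<open>These functionals test weak convergence on the whole domain, to recover the mass of the
  limit, and on the two active sets. In L^1 their bound is 1, since an indicator never exceeds
  1.\<close>

lemma bounded_functional_set_integral:
  fixes \<Omega> :: "'a::euclidean_space set"
  assumes "A \<in> sets (lebesgue_on \<Omega>)"
  shows "bounded_functional (Lp 1 \<Omega>) (Lp_norm 1 \<Omega>) (\<lambda>h. LINT x|lebesgue_on \<Omega>. h x * indicator A x)"
proof -
  have int: "integrable (lebesgue_on \<Omega>) h" if "h \<in> Lp 1 \<Omega>" for h
    using that integrable_norm_cancel[of "lebesgue_on \<Omega>" h] by (simp add: Lp_def)
  then have intA: "integrable (lebesgue_on \<Omega>) (\<lambda>x. h x * indicator A x)" if "h \<in> Lp 1 \<Omega>" for h
    using that assms by (intro integrable_real_mult_indicator) auto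
  have "\<bar>LINT x|lebesgue_on \<Omega>. h x * indicator A x\<bar> \<le> 1 * Lp_norm 1 \<Omega> h" if h: "h \<in> Lp 1 \<Omega>" for h
  proof -
    have "\<bar>LINT x|lebesgue_on \<Omega>. h x * indicator A x\<bar> \<le> (LINT x|lebesgue_on \<Omega>. \<bar>h x * indicator A x\<bar>)"
      by (rule integral_abs_bound)
    also have "\<dots> \<le> (LINT x|lebesgue_on \<Omega>. \<bar>h x\<bar>)"
      using int[OF h] intA[OF h] by (intro integral_mono) (auto simp: indicator_def)
    finally show ?thesis by (simp add: Lp_norm_def)
  qed
  then show ?thesis
    unfolding bounded_functional_def
    using intA by (intro conjI exI[of _ 1]) (auto simp: plus_fun_def scaleR_fun_def algebra_simps)
qed

text \<open>A number in the unit interval dominates its square. Convergence of the plain integrals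
  thus supplies the L^2 hypothesis of \<open>Lp_norm_tendsto_zero\<close>.\<close>

lemma integral_square_tendsto_zero:
  fixes a :: "nat \<Rightarrow> 'a \<Rightarrow> real"
  assumes fm: "finite_measure M" and a_meas: "\<And>k. a k \<in> borel_measurable M"
    and a_box: "\<And>k. AE x in M. 0 \<le> a k x \<and> a k x \<le> 1"
    and lim: "(\<lambda>k. LINT x|M. a k x) \<longlonglongrightarrow> 0"
  shows "(\<lambda>k. LINT x|M. a k x * a k x) \<longlonglongrightarrow> 0"
proof (rule tendsto_sandwich[OF _ _ tendsto_const lim])
  have a_abs: "AE x in M. \<bar>a k x\<bar> \<le> 1" for k
    using a_box[of k] by eventually_elim auto
  have "(LINT x|M. a k x * a k x) \<le> (LINT x|M. a k x)" for k
  proof (rule integral_mono_AE)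
    show "integrable M (\<lambda>x. a k x * a k x)" "integrable M (a k)"
      using finite_measure.integrable_mult_AE_bounded[OF fm a_meas a_meas a_abs a_abs]
        finite_measure.integrable_AE_bounded[OF fm a_meas a_abs] by blast+
    show "AE x in M. a k x * a k x \<le> a k x"
      using a_box[of k] by eventually_elim (simp add: mult_left_le)
  qed
  then show "eventually (\<lambda>k. (LINT x|M. a k x * a k x) \<le> (LINT x|M. a k x)) sequentially"
    by simp
qed simp

lemma converges_Lp_rangeI:
  fixes \<Omega> :: "'a::euclidean_space set"
  assumes fm: "finite_measure (lebesgue_on \<Omega>)" and r: "strict_mono r"
    and a_meas: "\<And>k. a k \<in> borel_measurable (lebesgue_on \<Omega>)"
    and a_box: "\<And>k. AE x in lebesgue_on \<Omega>. 0 \<le> a k x \<and> a k x \<le> 1"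
    and lim: "(\<lambda>k. LINT x|lebesgue_on \<Omega>. a (r k) x) \<longlonglongrightarrow> 0"
    and p: "1 \<le> p"
  shows "converges_Lp p \<Omega> (range r) a (\<lambda>_. 0)"
proof -
  have a_abs: "AE x in lebesgue_on \<Omega>. \<bar>a k x\<bar> \<le> 1" for k
    using a_box[of k] by eventually_elim auto
  have "a k \<in> Lp p \<Omega>" "(\<lambda>_. 0) \<in> Lp p \<Omega>" for k
    using Lp_AE_bounded[OF fm a_meas a_abs, of p] Lp_AE_bounded[OF fm, of "\<lambda>_. 0" 1 p] p by auto
  moreover have "(\<lambda>k. Lp_norm p \<Omega> (a (r k))) \<longlonglongrightarrow> 0"
    by (rule Lp_norm_tendsto_zero[OF fm a_meas a_abs p integral_square_tendsto_zero[OF fm a_meas a_box lim]])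
  ultimately show ?thesis
    by (auto simp: converges_Lp_def fun_diff_def intro!: tendsto_along_range[OF r])
qed

lemma converges_in_measure_rangeI:
  fixes \<Omega> :: "'a::euclidean_space set"
  assumes fm: "finite_measure (lebesgue_on \<Omega>)" and r: "strict_mono r"
    and a_meas: "\<And>k. a k \<in> borel_measurable (lebesgue_on \<Omega>)"
    and a_box: "\<And>k. AE x in lebesgue_on \<Omega>. 0 \<le> a k x \<and> a k x \<le> 1"
    and lim: "(\<lambda>k. LINT x|lebesgue_on \<Omega>. a (r k) x) \<longlonglongrightarrow> 0"
  shows "converges_in_measure \<Omega> (range r) a (\<lambda>_. 0)"
proof -
  have a_abs: "AE x in lebesgue_on \<Omega>. \<bar>a k x\<bar> \<le> 1" for k
    using a_box[of k] by eventually_elim auto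
  have "(\<lambda>k. measure (lebesgue_on \<Omega>) {x \<in> \<Omega>. \<bar>a (r k) x\<bar> \<ge> \<eta>}) \<longlonglongrightarrow> 0" if \<eta>: "0 < \<eta>" for \<eta>
  proof (rule tendsto_sandwich[OF _ _ tendsto_const])
    show "(\<lambda>k. (LINT x|lebesgue_on \<Omega>. a (r k) x) / \<eta>) \<longlonglongrightarrow> 0"
      using tendsto_divide[OF lim tendsto_const[of \<eta>]] \<eta> by simp
    have "measure (lebesgue_on \<Omega>) {x \<in> \<Omega>. \<bar>a k x\<bar> \<ge> \<eta>} \<le> (LINT x|lebesgue_on \<Omega>. a k x) / \<eta>" for k
    proof -
      have i: "integrable (lebesgue_on \<Omega>) (\<lambda>x. \<bar>a k x\<bar>)"
        using finite_measure.integrable_AE_bounded[OF fm a_meas a_abs] by simp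
      have "measure (lebesgue_on \<Omega>) {x \<in> space (lebesgue_on \<Omega>). \<bar>a k x\<bar> \<ge> \<eta>} \<le> (LINT x|lebesgue_on \<Omega>. \<bar>a k x\<bar>) / \<eta>"
        by (rule integral_Markov_inequality_measure[OF i sets.top _ \<eta>]) simp
      also have "(LINT x|lebesgue_on \<Omega>. \<bar>a k x\<bar>) = (LINT x|lebesgue_on \<Omega>. a k x)"
        using a_meas a_box[of k] by (intro integral_cong_AE) (auto elim: eventually_mono)
      finally show ?thesis by simp
    qed
    then show "eventually (\<lambda>k. measure (lebesgue_on \<Omega>) {x \<in> \<Omega>. \<bar>a (r k) x\<bar> \<ge> \<eta>}
        \<le> (LINT x|lebesgue_on \<Omega>. a (r k) x) / \<eta>) sequentially" by simp
  qed simp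
  then show ?thesis
    using a_meas by (auto simp: converges_in_measure_def intro!: tendsto_along_range[OF r])
qed

lemma converges_AE_rangeI:
  assumes r: "strict_mono r" and "AE x in lebesgue_on \<Omega>. (\<lambda>k. a (r k) x) \<longlonglongrightarrow> g x"
  shows "converges_AE \<Omega> (range r) a g"
  using assms(2) unfolding converges_AE_def by eventually_elim (rule tendsto_along_range[OF r])

text \<open>The subsequence for \<open>b\<close> is extracted from the one already found for
  \<open>a\<close>, and almost everywhere convergence of \<open>a\<close> survives the second
  extraction.\<close>

lemma common_AE_subsequence:
  fixes a b :: "nat \<Rightarrow> 'a \<Rightarrow> real"
  assumes a: "\<And>k. integrable M (a k)" "(\<lambda>k. LINT x|M. norm (a k x)) \<longlonglongrightarrow> 0"
    and b: "\<And>k. integrable M (b k)" "(\<lambda>k. LINT x|M. norm (b k x)) \<longlonglongrightarrow> 0"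
  obtains s where "strict_mono s" "AE x in M. (\<lambda>k. a (s k) x) \<longlonglongrightarrow> 0" "AE x in M. (\<lambda>k. b (s k) x) \<longlonglongrightarrow> 0"
proof -
  obtain s where s: "strict_mono s" "AE x in M. (\<lambda>k. a (s k) x) \<longlonglongrightarrow> 0"
    using tendsto_L1_AE_subseq[OF a] by blast
  have "(\<lambda>k. LINT x|M. norm (b (s k) x)) \<longlonglongrightarrow> 0"
    using LIMSEQ_subseq_LIMSEQ[OF b(2) s(1)] by (simp add: o_def)
  from tendsto_L1_AE_subseq[of M "\<lambda>k. b (s k)", OF b(1) this]
  obtain t where t: "strict_mono t" "AE x in M. (\<lambda>k. b (s (t k)) x) \<longlonglongrightarrow> 0"
    by blast
  have "AE x in M. (\<lambda>k. a (s (t k)) x) \<longlonglongrightarrow> 0"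
    using s(2) by eventually_elim (use LIMSEQ_subseq_LIMSEQ[OF _ t(1)] in \<open>force simp: o_def\<close>)
  then show ?thesis
    using that[of "s \<circ> t"] t strict_mono_o[OF s(1) t(1)] by simp
qed

section \<open>Weak limit of the iterates and their behaviour on its active sets\<close>

theorem proposition4p2:
  fixes \<Omega> \<Gamma>\<^sub>0 :: "(real^'d::finite) set"
    and \<theta> \<epsilon> \<rho>min s :: real
    and C :: "real^'d^'d \<Rightarrow> real^'d^'d"
    and f :: "(real^'d \<Rightarrow> real^'d) \<Rightarrow> real"
    and Fhat :: "(real^'d \<Rightarrow> real) \<times> (real^'d \<Rightarrow> real^'d) \<Rightarrow> real"
    and F' :: "(real^'d \<Rightarrow> real) \<Rightarrow> (real^'d \<Rightarrow> real) \<Rightarrow> real"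
    and gradF :: "(real^'d \<Rightarrow> real) \<Rightarrow> real^'d \<Rightarrow> real"
    and \<alpha> :: "nat \<Rightarrow> real"
    and \<rho> :: "nat \<Rightarrow> real^'d \<Rightarrow> real"
  assumes dim: "CARD('d) = 2 \<or> CARD('d) = 3"
    and domain: "open \<Omega>" "connected \<Omega>" "\<Omega> \<noteq> {}" "bounded \<Omega>" "lipschitz_boundary \<Omega>"
    and theta: "0 \<le> \<theta>" "\<theta> \<le> 1"
    and Gamma0: "\<Gamma>\<^sub>0 \<subseteq> frontier \<Omega>" "hausdorff_outer (CARD('d) - 1) \<Gamma>\<^sub>0 > 0"
    and params: "\<epsilon> > 0" "0 < \<rho>min" "\<rho>min < 1" "s > 1"
    and tensor: "elasticity_tensor C"
    and force: "bounded_functional (displacement_space \<Omega> \<Gamma>\<^sub>0) (H1vec_norm \<Omega>) f"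
    and Fhat_diff: "\<forall>w \<in> H1 \<Omega> \<times> H1vec \<Omega>. \<exists>D.
          has_frechet_derivative_within (H1 \<Omega> \<times> H1vec \<Omega>) (H1prod_norm \<Omega>) (H1 \<Omega> \<times> H1vec \<Omega>) Fhat D w"
    and F_deriv: "\<forall>r \<in> admissible \<theta> \<Omega>.
          has_frechet_derivative_within (Linf \<Omega>) (Linf_norm \<Omega>) (Linf \<Omega> \<inter> box_constraint \<Omega>)
            (reduced_objective \<Omega> \<Gamma>\<^sub>0 \<epsilon> \<rho>min s C f Fhat) (F' r) r"
    and gradF: "\<forall>r \<in> admissible \<theta> \<Omega>. gradF r \<in> Linf \<Omega> \<and>
          (\<forall>q \<in> Linf \<Omega>. F' r q = (LINT x|lebesgue_on \<Omega>. gradF r x * q x))"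
    and alpha: "\<forall>k. \<alpha> k > 0"
    and rho0: "\<rho> 0 \<in> int_admissible \<theta> \<Omega>"
    and update: "\<forall>k. simpl_step \<Omega> \<theta> (\<alpha> k) (gradF (\<rho> k)) (\<rho> k) (\<rho> (Suc k))"
  shows "\<exists>Kw \<rho>star. infinite Kw \<and> \<rho>star \<in> admissible \<theta> \<Omega> \<and>
    (\<forall>p\<ge>1. weakly_converges_Lp p \<Omega> Kw \<rho> \<rho>star) \<and>
    (let \<Omega>1 = {x \<in> \<Omega>. \<rho>star x = 1};
         \<Omega>0 = {x \<in> \<Omega>. \<rho>star x = 0};
         a = (\<lambda>k x. (1 - \<rho> k x) * indicator \<Omega>1 x);
         b = (\<lambda>k x. \<rho> k x * indicator \<Omega>0 x)
     in converges_in_measure \<Omega> Kw a (\<lambda>_. 0) \<and>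
        converges_in_measure \<Omega> Kw b (\<lambda>_. 0) \<and>
        (\<exists>Kpn. Kpn \<subseteq> Kw \<and> infinite Kpn \<and>
           converges_AE \<Omega> Kpn a (\<lambda>_. 0) \<and>
           converges_AE \<Omega> Kpn b (\<lambda>_. 0) \<and>
           (\<forall>p\<ge>1. converges_Lp p \<Omega> Kpn a (\<lambda>_. 0) \<and> converges_Lp p \<Omega> Kpn b (\<lambda>_. 0))))"
proof -
  let ?M = "lebesgue_on \<Omega>"
  have \<Omega>: "\<Omega> \<in> sets lebesgue" using domain(1) by (simp add: borel_open)
  have fm: "finite_measure ?M"
    using domain(1,4) by (simp add: bounded_set_imp_lmeasurable borel_open finite_measure_lebesgue_on)
  \<comment> \<open>The gradient is known to lie in \<open>Linf \<Omega>\<close> only at admissible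
    densities, so each step relies on admissibility of the previous iterate.\<close>
  have \<rho>: "\<rho> k \<in> admissible \<theta> \<Omega>" for k
  proof (induction k)
    case 0
    show ?case using rho0 int_admissible_subset by blast
  next
    case (Suc k)
    then show ?case using simpl_step_admissible[OF \<Omega> Suc] gradF update by blast
  qed
  note \<rho>_meas = admissibleD(1)[OF \<rho>] and \<rho>_box = admissibleD(2)[OF \<rho>]
  obtain r g where r: "strict_mono r" and g_meas: "g \<in> borel_measurable ?M"
    and g_box: "AE x in ?M. 0 \<le> g x \<and> g x \<le> 1"
    and orth: "\<And>j. (\<lambda>k. LINT x|?M. (\<rho> (r j) x - g x) * (\<rho> (r k) x - g x)) \<longlonglongrightarrow> 0"
    by (rule finite_measure.weak_limit_exists[OF fm, where f = \<rho>, OF \<rho>_meas \<rho>_box]) (rule that; simp)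
  have weak: "weakly_converges_Lp p \<Omega> (range r) \<rho> g" if "1 \<le> p" for p
    using weakly_converges_Lp_rangeI[OF fm r, where f = \<rho>, OF \<rho>_meas \<rho>_box g_meas g_box orth that] .
  have set_lim: "(\<lambda>k. LINT x|?M. \<rho> (r k) x * indicator A x) \<longlonglongrightarrow> (LINT x|?M. g x * indicator A x)"
    if "A \<in> sets ?M" for A
  proof -
    have "((\<lambda>k. LINT x|?M. \<rho> k x * indicator A x) \<longlongrightarrow> (LINT x|?M. g x * indicator A x)) (along (range r))"
      by (rule weakly_converges_LpD[OF weak[OF order_refl] bounded_functional_set_integral[OF that]])
    \<comment> \<open>This goes back from the index set to the sequence: \<open>r\<close> tends to
      infinity inside its own range, so a limit along \<open>range r\<close> can be composed with
      \<open>r\<close>.\<close>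
    moreover have "filterlim r (along (range r)) sequentially"
      using filterlim_subseq[OF r] by (simp add: along_def filterlim_inf filterlim_principal)
    ultimately show ?thesis by (rule filterlim_compose)
  qed
  \<comment> \<open>Testing with the indicator of the whole domain gives a constant sequence, so the
    limit inherits the mass.\<close>
  have "(LINT x|?M. g x) = \<theta> * measure lebesgue \<Omega>"
  proof -
    have restr: "(LINT x|?M. h x * indicator \<Omega> x) = (LINT x|?M. h x)" for h :: "real^'d \<Rightarrow> real"
      by (rule Bochner_Integration.integral_cong) auto
    have "\<Omega> \<in> sets ?M" using sets.top[of ?M] by simp
    from set_lim[OF this] show ?thesis
      using LIMSEQ_unique[OF _ tendsto_const] by (simp add: restr admissibleD(3)[OF \<rho>])
  qed
  then have g: "g \<in> admissible \<theta> \<Omega>"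
    using g_meas g_box by (intro admissibleI)

  define \<Omega>1 where "\<Omega>1 = {x \<in> \<Omega>. g x = 1}"
  define \<Omega>0 where "\<Omega>0 = {x \<in> \<Omega>. g x = 0}"
  define a where "a k x = (1 - \<rho> k x) * indicator \<Omega>1 x" for k x
  define b where "b k x = \<rho> k x * indicator \<Omega>0 x" for k x
  have "{x \<in> space ?M. g x = c} \<in> sets ?M" for c
    using g_meas by measurable
  then have sets: "\<Omega>1 \<in> sets ?M" "\<Omega>0 \<in> sets ?M" by (auto simp: \<Omega>1_def \<Omega>0_def)
  have a_meas: "a k \<in> borel_measurable ?M" and b_meas: "b k \<in> borel_measurable ?M" for k
    using \<rho>_meas[of k] sets unfolding a_def[abs_def] b_def[abs_def] by measurable
  have a_box: "AE x in ?M. 0 \<le> a k x \<and> a k x \<le> 1" and b_box: "AE x in ?M. 0 \<le> b k x \<and> b k x \<le> 1" for k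
    using \<rho>_box[of k] by (auto simp: a_def b_def indicator_def elim: eventually_mono)
  have a_int: "integrable ?M (a k)" for k
    by (rule finite_measure.integrable_AE_bounded[OF fm, where a = 1, OF a_meas eventually_mono[OF a_box[of k]]]) simp
  have b_int: "integrable ?M (b k)" for k
    by (rule finite_measure.integrable_AE_bounded[OF fm, where a = 1, OF b_meas eventually_mono[OF b_box[of k]]]) simp
  have b_lim: "(\<lambda>k. LINT x|?M. b (r k) x) \<longlonglongrightarrow> 0"
  proof -
    have "(\<lambda>x. g x * indicator \<Omega>0 x) = (\<lambda>x. 0)"
      by (auto simp: \<Omega>0_def indicator_def)
    then show ?thesis using set_lim[OF sets(2)] by (simp add: b_def)
  qed
  \<comment> \<open>On \<open>\<Omega>1\<close> the limit \<open>g\<close> equals 1, so the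
    integrals of \<open>\<rho> (r k)\<close> over this set tend to its measure and the defect tends
    to zero.\<close>
  have a_lim: "(\<lambda>k. LINT x|?M. a (r k) x) \<longlonglongrightarrow> 0"
  proof -
    have i1: "integrable ?M (\<lambda>x. indicator \<Omega>1 x :: real)"
      using sets(1) finite_measure.emeasure_finite[OF fm] by (simp add: less_top)
    have "(LINT x|?M. a k x) = (LINT x|?M. indicator \<Omega>1 x) - (LINT x|?M. \<rho> k x * indicator \<Omega>1 x)" for k
    proof -
      have "integrable ?M (\<lambda>x. \<rho> k x * indicator \<Omega>1 x)"
        using Bochner_Integration.integrable_diff[OF i1 a_int[of k]] by (simp add: a_def left_diff_distrib)
      with i1 show ?thesis by (simp add: a_def left_diff_distrib)
    qed
    moreover have "(\<lambda>x. g x * indicator \<Omega>1 x) = (\<lambda>x. indicator \<Omega>1 x)"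
      by (auto simp: \<Omega>1_def indicator_def)
    ultimately show ?thesis
      using tendsto_diff[OF tendsto_const[of "LINT x|?M. indicator \<Omega>1 x"] set_lim[OF sets(1)]]
      by simp
  qed
  \<comment> \<open>The sign is decisive: with values in the unit interval nothing cancels, and
    convergence of the integrals is already convergence in L^1.\<close>
  have a_norm: "(LINT x|?M. norm (a k x)) = (LINT x|?M. a k x)" for k
    by (rule integral_cong_AE[OF measurable_compose[OF a_meas borel_measurable_norm] a_meas eventually_mono[OF a_box[of k]]]) simp
  have b_norm: "(LINT x|?M. norm (b k x)) = (LINT x|?M. b k x)" for k
    by (rule integral_cong_AE[OF measurable_compose[OF b_meas borel_measurable_norm] b_meas eventually_mono[OF b_box[of k]]]) simp
  obtain t where t: "strict_mono t" "AE x in ?M. (\<lambda>k. a (r (t k)) x) \<longlonglongrightarrow> 0"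
      "AE x in ?M. (\<lambda>k. b (r (t k)) x) \<longlonglongrightarrow> 0"
    by (rule common_AE_subsequence[of ?M "\<lambda>k. a (r k)" "\<lambda>k. b (r k)"])
      (simp_all only: a_int b_int a_lim b_lim a_norm b_norm)
  have rt: "strict_mono (r \<circ> t)" by (rule strict_mono_o[OF r t(1)])
  have lims: "(\<lambda>k. LINT x|?M. a ((r \<circ> t) k) x) \<longlonglongrightarrow> 0" "(\<lambda>k. LINT x|?M. b ((r \<circ> t) k) x) \<longlonglongrightarrow> 0"
    using LIMSEQ_subseq_LIMSEQ[OF a_lim t(1)] LIMSEQ_subseq_LIMSEQ[OF b_lim t(1)] by (simp_all add: o_def)
  \<comment> \<open>The second index set is \<open>range (r \<circ> t)\<close>. Passing to
    \<open>t\<close> serves the pointwise limits; the integrals already tend to zero along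
    \<open>r\<close>, and so along this subsequence too.\<close>
  have "converges_AE \<Omega> (range (r \<circ> t)) a (\<lambda>_. 0)" "converges_AE \<Omega> (range (r \<circ> t)) b (\<lambda>_. 0)"
    by (rule converges_AE_rangeI[OF rt]; use t in simp)+
  moreover have "converges_Lp p \<Omega> (range (r \<circ> t)) a (\<lambda>_. 0) \<and> converges_Lp p \<Omega> (range (r \<circ> t)) b (\<lambda>_. 0)"
    if "1 \<le> p" for p
    using converges_Lp_rangeI[OF fm rt, where a = a, OF a_meas a_box lims(1) that]
      converges_Lp_rangeI[OF fm rt, where a = b, OF b_meas b_box lims(2) that] ..
  ultimately have pn: "\<exists>Kpn. Kpn \<subseteq> range r \<and> infinite Kpn \<and>
      converges_AE \<Omega> Kpn a (\<lambda>_. 0) \<and> converges_AE \<Omega> Kpn b (\<lambda>_. 0) \<and>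
      (\<forall>p\<ge>1. converges_Lp p \<Omega> Kpn a (\<lambda>_. 0) \<and> converges_Lp p \<Omega> Kpn b (\<lambda>_. 0))"
    using infinite_range_strict_mono[OF rt] by (intro exI[of _ "range (r \<circ> t)"]) auto
  show ?thesis
    unfolding Let_def
    using infinite_range_strict_mono[OF r] g weak pn
      converges_in_measure_rangeI[OF fm r, where a = a, OF a_meas a_box a_lim]
      converges_in_measure_rangeI[OF fm r, where a = b, OF b_meas b_box b_lim]
    unfolding a_def[abs_def] b_def[abs_def] \<Omega>1_def \<Omega>0_def
    by - (rule exI[of _ "range r"], rule exI[of _ g], simp)
qed

end
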